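(* Consider a critically loaded system, $\rho=1$. (i) Let $J\ge2$. Any server type $j$ that is a leaf in the basic activity tree does not affect the local stability of the system. Namely, let us modify the system by removing type $j$, and then replacing $\lambda_i$ for the unique $i$ adjacent to $j$ by $\lambda_i-\beta_j\mu_{ij}$. Then the original system is locally stable if and only if the modified one is. (ii) Say that a (critically loaded) system $S'$ is an expansion of a (critically loaded) system $S$ if it is obtained from $S$ by the following modification. Pick one server type $j$ and one customer type $i$ adjacent to it in $\mathcal E$; "split" type $j$ into two types $j'$ and $j''$; connect type $i$ to both $j'$ and $j''$; connect each of the remaining types $i'\in\mathcal C(j)\setminus\{i\}$ to either $j'$ or $j''$ (but not both); for each new edge (including those at $i$) the service rate is inherited from $j$, i.e. if $(kj')$ (respectively $(kj'')$) is a new edge, set $\mu_{kj'}=\mu_{kj}$ (respectively $\mu_{kj''}=\mu_{kj}$). Then $S$ is locally stable if and only if $S'$ is. (iii) A system with four or fewer customer types is locally stable.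
   Context: Model. Customer types $i\in\mathcal I$, $|\mathcal I|=I$; server pools (server types) $j\in\mathcal J$, $|\mathcal J|=J$ (finite). Parameters: $\lambda_i>0$, $\beta_j>0$, $\mu_{ij}\ge 0$ ($\mu_{ij}=0$ means pool $j$ cannot serve type $i$). Static planning problem (SPP): minimize $\rho$ over $(\lambda_{ij}),\rho$ subject to $\lambda_{ij}\ge0$, $\sum_j\lambda_{ij}=\lambda_i$ for all $i$, and $\sum_i\lambda_{ij}/(\beta_j\mu_{ij})\le\rho$ for all $j$. Standing assumption (complete resource pooling): the SPP has a unique optimal solution $(\lambda_{ij}),\rho$, and the set of basic activities $\mathcal E=\{(ij):\lambda_{ij}>0\}$ is the edge set of a (connected) tree on the vertex set $\mathcal I\cup\mathcal J$ (the basic activity tree). $\mathcal S(i)=\{j:(ij)\in\mathcal E\}$, $\mathcal C(j)=\{i:(ij)\in\mathcal E\}$. A leaf is a node of degree one in this tree. Matrices. For $y\in\mathbb R^I$ let $z=My\in\mathbb R^{\mathcal E}$ be the unique solution of $\sum_{i\in\mathcal C(j)}z_{ij}=\eta\beta_j$ for all $j$ and $\sum_{j\in\mathcal S(i)}z_{ij}=y_i$ for all $i$, where $\eta=\sum_iy_i/\sum_j\beta_j$. $A_u$ is the $I\times I$ matrix of $y\mapsto\big(-\sum_{j\in\mathcal S(i)}\mu_{ij}(My)_{ij}\big)_{i}$, and $A_c$ is the $I\times I$ matrix with entries $(A_c)_{ii'}=(A_u)_{ii'}-\frac1I\sum_k(A_u)_{ki'}$; it governs the critically loaded fluid model near an equilibrium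 point with equal positive queues. A critically loaded system is locally stable if all eigenvalues of its matrix $A_c$ have negative real part except one simple eigenvalue $0$. The restriction of $A_c$ to $\{y:\sum_iy_i=0\}$, and hence local stability, depends only on $(\mu_{ij})_{(ij)\in\mathcal E}$ and $\mathcal E$, so the pool sizes and input rates of the expanded system in (ii) need not be specified beyond its being critically loaded with the described tree as basic activity tree. *)

theory Defs
  imports "Jordan_Normal_Form.Char_Poly" Complex_Main
begin

text \<open>Customer types are numbered \<open>0, \<dots>, n - 1\<close>, so that the \<open>I \<times> I\<close> matrices are of type
  \<open>mat\<close>. Server types form a finite set, so that they can be removed and added. Values of the
  parameter functions outside the index ranges carry no meaning.\<close>

record 'j system =
  ncust :: nat
  servers :: "'j set"
  arrival :: "nat \<Rightarrow> real"              (* lambda_i *)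
  pool :: "'j \<Rightarrow> real"                  (* beta_j *)
  srate :: "nat \<Rightarrow> 'j \<Rightarrow> real"          (* mu_ij *)

definition valid_system :: "'j system \<Rightarrow> bool" where
  "valid_system S \<longleftrightarrow>
     0 < ncust S \<and> finite (servers S) \<and> servers S \<noteq> {} \<and>
     (\<forall>i<ncust S. 0 < arrival S i) \<and>
     (\<forall>j\<in>servers S. 0 < pool S j) \<and>
     (\<forall>i<ncust S. \<forall>j\<in>servers S. 0 \<le> srate S i j)"

subsection \<open>Static planning problem\<close>

text \<open>Since \<open>x / 0 = 0\<close> in HOL, the constraint that no flow is routed along \<open>(i, j)\<close> with
  \<open>\<mu>\<^sub>i\<^sub>j = 0\<close> is stated explicitly. Flows are set to \<open>0\<close> outside the index set, so that uniqueness
  can be expressed by \<open>\<exists>!\<close>.\<close>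

definition spp_feasible :: "'j system \<Rightarrow> (nat \<Rightarrow> 'j \<Rightarrow> real) \<Rightarrow> real \<Rightarrow> bool" where
  "spp_feasible S l r \<longleftrightarrow>
     (\<forall>i j. 0 \<le> l i j) \<and>
     (\<forall>i j. \<not> (i < ncust S \<and> j \<in> servers S \<and> srate S i j \<noteq> 0) \<longrightarrow> l i j = 0) \<and>
     (\<forall>i<ncust S. (\<Sum>j\<in>servers S. l i j) = arrival S i) \<and>
     (\<forall>j\<in>servers S. (\<Sum>i<ncust S. l i j / (pool S j * srate S i j)) \<le> r)"

definition spp_optimal :: "'j system \<Rightarrow> (nat \<Rightarrow> 'j \<Rightarrow> real) \<times> real \<Rightarrow> bool" where
  "spp_optimal S p \<longleftrightarrow>
     spp_feasible S (fst p) (snd p) \<and> (\<forall>l r. spp_feasible S l r \<longrightarrow> snd p \<le> r)"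

definition spp_solution :: "'j system \<Rightarrow> (nat \<Rightarrow> 'j \<Rightarrow> real) \<times> real" where
  "spp_solution S = (THE p. spp_optimal S p)"

definition basic_activities :: "'j system \<Rightarrow> (nat \<times> 'j) set" where
  "basic_activities S =
     {(i, j). i < ncust S \<and> j \<in> servers S \<and> 0 < fst (spp_solution S) i j}"

subsection \<open>The basic activity tree\<close>

definition adjacency :: "(nat \<times> 'j) set \<Rightarrow> ((nat + 'j) \<times> (nat + 'j)) set" where
  "adjacency E = (\<Union>(i, j)\<in>E. {(Inl i, Inr j), (Inr j, Inl i)})"

text \<open>\<open>N\<close> is a symmetric irreflexive adjacency relation on the vertex set \<open>V\<close>; a cycle is a list of
  at least three distinct vertices, consecutive ones (cyclically) being adjacent.\<close>

definition undirected_tree :: "'v set \<Rightarrow> ('v \<times> 'v) set \<Rightarrow> bool" where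
  "undirected_tree V N \<longleftrightarrow>
     V \<noteq> {} \<and> (\<forall>u\<in>V. \<forall>v\<in>V. (u, v) \<in> N\<^sup>*) \<and>
     \<not> (\<exists>c. 3 \<le> length c \<and> distinct c \<and>
            (\<forall>k<length c. (c ! k, c ! (Suc k mod length c)) \<in> N))"

definition leaf :: "('v \<times> 'v) set \<Rightarrow> 'v \<Rightarrow> bool" where
  "leaf N v \<longleftrightarrow> card {w. (v, w) \<in> N} = 1"

definition complete_resource_pooling :: "'j system \<Rightarrow> bool" where
  "complete_resource_pooling S \<longleftrightarrow>
     (\<exists>!p. spp_optimal S p) \<and>
     undirected_tree (Inl ` {..<ncust S} \<union> Inr ` servers S) (adjacency (basic_activities S))"

definition critically_loaded :: "'j system \<Rightarrow> bool" where
  "critically_loaded S \<longleftrightarrow>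
     valid_system S \<and> complete_resource_pooling S \<and> snd (spp_solution S) = 1"

definition custs_of :: "'j system \<Rightarrow> 'j \<Rightarrow> nat set" where
  "custs_of S j = {i. (i, j) \<in> basic_activities S}"

definition servers_of :: "'j system \<Rightarrow> nat \<Rightarrow> 'j set" where
  "servers_of S i = {j. (i, j) \<in> basic_activities S}"

subsection \<open>Matrices and local stability\<close>

text \<open>An element of \<open>\<real>\<^sup>\<E>\<close> is a function that vanishes outside \<open>\<E>\<close>.\<close>

definition M_map :: "'j system \<Rightarrow> real vec \<Rightarrow> nat \<Rightarrow> 'j \<Rightarrow> real" where
  "M_map S y = (THE z.
     (\<forall>i j. (i, j) \<notin> basic_activities S \<longrightarrow> z i j = 0) \<and>
     (\<forall>j\<in>servers S. (\<Sum>i\<in>custs_of S j. z i j) =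
        (\<Sum>i<ncust S. y $ i) / (\<Sum>j\<in>servers S. pool S j) * pool S j) \<and>
     (\<forall>i<ncust S. (\<Sum>j\<in>servers_of S i. z i j) = y $ i))"

definition A_u :: "'j system \<Rightarrow> real mat" where
  "A_u S = mat (ncust S) (ncust S) (\<lambda>(i, k).
     - (\<Sum>j\<in>servers_of S i. srate S i j * M_map S (unit_vec (ncust S) k) i j))"

definition A_c :: "'j system \<Rightarrow> real mat" where
  "A_c S = mat (ncust S) (ncust S) (\<lambda>(i, k).
     A_u S $$ (i, k) - (1 / real (ncust S)) * (\<Sum>l<ncust S. A_u S $$ (l, k)))"

text \<open>The eigenvalue \<open>0\<close> is simple in the algebraic sense: it is a root of multiplicity one of the
  characteristic polynomial.\<close>

definition locally_stable :: "'j system \<Rightarrow> bool" where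
  "locally_stable S \<longleftrightarrow>
     (let A = map_mat complex_of_real (A_c S)
      in Polynomial.order 0 (char_poly A) = 1 \<and>
         (\<forall>e. eigenvalue A e \<and> e \<noteq> 0 \<longrightarrow> Re e < 0))"

subsection \<open>Modifications of a system\<close>

definition remove_leaf :: "'j system \<Rightarrow> nat \<Rightarrow> 'j \<Rightarrow> 'j system" where
  "remove_leaf S i j = S\<lparr>
     servers := servers S - {j},
     arrival := (arrival S)(i := arrival S i - pool S j * srate S i j)\<rparr>"

text \<open>Type \<open>j\<close> is split into \<open>j'\<close> and \<open>j''\<close>, customer type \<open>i\<close> is connected to both of them, the types
  in \<open>K\<close> to \<open>j'\<close> and the other ones in \<open>\<C>(j)\<close> to \<open>j''\<close>. Pool sizes, input rates and the service
  rates outside the basic activities of the expanded system are constrained only by its being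
  critically loaded with the prescribed basic activities.\<close>

definition expansion :: "'j system \<Rightarrow> 'j system \<Rightarrow> bool" where
  "expansion S S' \<longleftrightarrow>
     critically_loaded S \<and> critically_loaded S' \<and>
     (\<exists>i j j' j'' K.
        (i, j) \<in> basic_activities S \<and>
        j' \<noteq> j'' \<and> j' \<notin> servers S - {j} \<and> j'' \<notin> servers S - {j} \<and>
        K \<subseteq> custs_of S j - {i} \<and>
        ncust S' = ncust S \<and>
        servers S' = (servers S - {j}) \<union> {j', j''} \<and>
        basic_activities S' =
          {(k, m) \<in> basic_activities S. m \<noteq> j} \<union>
          (insert i K) \<times> {j'} \<union> (custs_of S j - K) \<times> {j''} \<and>
        (\<forall>(k, m) \<in> basic_activities S. m \<noteq> j \<longrightarrow> srate S' k m = srate S k m) \<and>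
        (\<forall>k \<in> insert i K. srate S' k j' = srate S k j) \<and>
        (\<forall>k \<in> custs_of S j - K. srate S' k j'' = srate S k j))"

end

theory Submission
  imports Defs
begin

text \<open>Let \<open>z = M y\<close> be the flow of an eigenvector \<open>y\<close> of \<open>A\<^sub>c\<close> with \<open>\<Sum> y = 0\<close> and
  eigenvalue \<open>e\<close>. Then \<open>z\<close> is balanced at every server, and \<open>\<Sum>\<^sub>j (e + \<mu>\<^sub>i\<^sub>j) z\<^sub>i\<^sub>j\<close> does not depend on
  the customer \<open>i\<close>; conversely every such flow comes from an eigenvector, because a flow on a tree is
  determined by its node sums. Local stability thus means that there is no nonzero flow of this kind
  with \<open>Re e \<ge> 0\<close>. A leaf server carries no balanced flow, and splitting a server merely splits the
  flow through it, which gives (i) and (ii). For at most four customers, either some customer shares a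
  server with all others, or the customers form a path; in the first case the flow is
  eliminated directly, in the second one is left with a cubic polynomial that satisfies the
  Routh--Hurwitz condition.\<close>

subsection \<open>Flows on bipartite trees\<close>

text \<open>The pool sizes drop out because the sum of \<open>y\<close> is zero, so the factor eta
  in the definition of the flow map vanishes. Passing to this hyperplane loses nothing: the columns
  of \<open>A_c S\<close> sum to zero, so its characteristic polynomial is X times that of the
  restriction, and simplicity of the eigenvalue 0 says exactly that 0 is not an eigenvalue of the
  restriction. Hence the one condition \<open>0 \<le> Re e\<close>, with \<open>e = 0\<close>
  included, covers both clauses of \<open>locally_stable\<close>. In (i) the modes are easy to
  compare; the real work is to show that the reduced system is again critically loaded. There the
  uniqueness of the optimum enters: it forces every server to be fully loaded, so that the leaf
  carries exactly the flow subtracted from \<open>arrival\<close>. For customers in a path, three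
  edge flows and the common value \<open>t\<close> satisfy four homogeneous equations. The middle
  flow can be computed from either end, which is why the determinant is a sum of two products of
  three factors linear in \<open>e\<close>.\<close>

lemma cycle_of_degree_ge_2:
  fixes R :: "'v rel"
  assumes fin: "finite (Field R)" and ne: "R \<noteq> {}"
    and sym: "sym R" and irr: "irrefl R"
    and deg: "\<And>u v. (u, v) \<in> R \<Longrightarrow> \<exists>w. w \<noteq> v \<and> (u, w) \<in> R"
  shows "\<exists>c. 3 \<le> length c \<and> distinct c \<and> (\<forall>k<length c. (c ! k, c ! (Suc k mod length c)) \<in> R)"
proof -
  \<comment> \<open>\<open>P\<close> describes simple paths along \<open>R\<close>. The first vertex
    of a longest one has a neighbour \<open>w\<close> other than the second vertex. By maximality
    \<open>w\<close> lies on the path, at an index \<open>m\<close> of at least 2, and the segment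
    up to \<open>w\<close> closes to a cycle.\<close>
  define P where "P xs \<longleftrightarrow> 2 \<le> length xs \<and> distinct xs \<and> set xs \<subseteq> Field R \<and>
    (\<forall>k. Suc k < length xs \<longrightarrow> (xs ! k, xs ! Suc k) \<in> R)" for xs
  obtain u v where uv: "(u, v) \<in> R" using ne by auto
  then have "P [u, v]"
    using irr by (auto simp: P_def irrefl_def Field_def less_Suc_eq)
  moreover have "length xs < Suc (card (Field R))" if "P xs" for xs
    using that fin card_mono distinct_card unfolding P_def by (metis less_Suc_eq_le)
  ultimately have "\<exists>xs. P xs \<and> (\<forall>ys. P ys \<longrightarrow> length ys \<le> length xs)"
    by (intro ex_has_greatest_nat) blast+
  then obtain xs where xs: "P xs" and max: "\<And>ys. P ys \<Longrightarrow> length ys \<le> length xs"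
    by blast
  have len: "2 \<le> length xs" using xs by (simp add: P_def)
  then have "(xs ! 0, xs ! 1) \<in> R" using xs by (auto simp: P_def)
  then obtain w where w: "w \<noteq> xs ! 1" "(xs ! 0, w) \<in> R" using deg by blast
  have "w \<in> set xs"
  proof (rule ccontr)
    assume "w \<notin> set xs"
    have "P (w # xs)"
      unfolding P_def
    proof (intro conjI allI impI)
      show "set (w # xs) \<subseteq> Field R" using xs w by (auto simp: P_def Field_def)
      show "((w # xs) ! k, (w # xs) ! Suc k) \<in> R" if "Suc k < length (w # xs)" for k
        using that xs w sym by (cases k) (auto simp: P_def sym_def)
    qed (use xs \<open>w \<notin> set xs\<close> in \<open>auto simp: P_def\<close>)
    from max[OF this] show False by simp
  qed
  then obtain m where m: "m < length xs" "w = xs ! m" by (auto simp: in_set_conv_nth)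
  have "m \<noteq> 0" using w(2) irr m(2) by (metis irrefl_def)
  moreover have "m \<noteq> 1" using w m by auto
  ultimately have m2: "2 \<le> m" by linarith
  let ?c = "take (Suc m) xs"
  have lc: "length ?c = Suc m" using m by simp
  have "(?c ! k, ?c ! (Suc k mod length ?c)) \<in> R" if "k < length ?c" for k
  proof (cases "k = m")
    case True
    then show ?thesis using lc m w sym by (auto simp: sym_def)
  next
    case False
    then have "Suc k < Suc m" using that lc by linarith
    then show ?thesis using lc m xs by (auto simp: P_def)
  qed
  moreover have "distinct ?c" using xs by (simp add: P_def)
  ultimately show ?thesis using lc m2 by (intro exI[of _ ?c]) auto
qed

lemma rtrancl_leaves_set:
  assumes "(u, v) \<in> R\<^sup>*" "u \<in> A" "v \<notin> A"
  shows "\<exists>x y. (x, y) \<in> R \<and> x \<in> A \<and> y \<notin> A"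
  using assms by (induction rule: rtrancl_induct) blast+

lemma adjacency_simps [simp]:
  "(Inl i, Inr j) \<in> adjacency E \<longleftrightarrow> (i, j) \<in> E"
  "(Inr j, Inl i) \<in> adjacency E \<longleftrightarrow> (i, j) \<in> E"
  "(Inl i, Inl k) \<notin> adjacency E"
  "(Inr j, Inr l) \<notin> adjacency E"
  by (auto simp: adjacency_def)

lemma adjacency_cases:
  assumes "(u, v) \<in> adjacency E"
  obtains i j where "u = Inl i" "v = Inr j" "(i, j) \<in> E"
  | i j where "u = Inr j" "v = Inl i" "(i, j) \<in> E"
  using assms by (auto simp: adjacency_def)

lemma ex_other_nonzero_summand:
  fixes f :: "'a \<Rightarrow> 'b::comm_monoid_add"
  assumes "finite A" "sum f A = 0" "a \<in> A" "f a \<noteq> 0"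
  shows "\<exists>b\<in>A. b \<noteq> a \<and> f b \<noteq> 0"
proof (rule ccontr)
  assume "\<not> ?thesis"
  then have "sum f (A - {a}) = 0" by (intro sum.neutral) auto
  then have "sum f A = f a" using assms by (simp add: sum.remove)
  then show False using assms by simp
qed

section \<open>Uniqueness and existence of flows on a tree, and cuts\<close>

locale bipartite_tree =
  fixes n :: nat and J :: "'j set" and E :: "(nat \<times> 'j) set"
  assumes finite_J: "finite J"
    and E_subset: "E \<subseteq> {..<n} \<times> J"
    and tree: "undirected_tree (Inl ` {..<n} \<union> Inr ` J) (adjacency E)"
begin

lemma connected:
  assumes "u \<in> Inl ` {..<n} \<union> Inr ` J" "v \<in> Inl ` {..<n} \<union> Inr ` J"
  shows "(u, v) \<in> (adjacency E)\<^sup>*"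
  using tree assms unfolding undirected_tree_def by blast

lemma no_cycle:
  assumes "3 \<le> length c" "distinct c"
    and "\<And>k. k < length c \<Longrightarrow> (c ! k, c ! (Suc k mod length c)) \<in> adjacency E"
  shows False
  using tree assms unfolding undirected_tree_def by blast

text \<open>A vanishing sum cannot have exactly one nonzero term, so in the support of
  \<open>z\<close> every non-isolated vertex has degree at least two, and the support would contain
  a cycle. The general codomain covers both the real flows behind \<open>M_map\<close> and the
  complex modes.\<close>

lemma circulation_eq_0:
  fixes z :: "nat \<Rightarrow> 'j \<Rightarrow> 'a::comm_monoid_add"
  assumes supp: "\<And>i j. (i, j) \<notin> E \<Longrightarrow> z i j = 0"
    and col: "\<And>j. j \<in> J \<Longrightarrow> (\<Sum>i<n. z i j) = 0"
    and row: "\<And>i. i < n \<Longrightarrow> (\<Sum>j\<in>J. z i j) = 0"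
  shows "z i j = 0"
proof (rule ccontr)
  assume nz: "z i j \<noteq> 0"
  define F where "F = {(i, j). z i j \<noteq> 0}"
  have FE: "F \<subseteq> E" using supp by (auto simp: F_def)
  have "\<exists>c. 3 \<le> length c \<and> distinct c \<and>
    (\<forall>k<length c. (c ! k, c ! (Suc k mod length c)) \<in> adjacency F)"
  proof (rule cycle_of_degree_ge_2)
    have "Field (adjacency F) \<subseteq> Inl ` {..<n} \<union> Inr ` J"
      using FE E_subset by (auto simp: Field_def adjacency_def)
    then show "finite (Field (adjacency F))" using finite_J by (auto intro: finite_subset)
    show "adjacency F \<noteq> {}" using nz by (auto simp: adjacency_def F_def)
    show "sym (adjacency F)" by (auto simp: sym_def adjacency_def)
    show "irrefl (adjacency F)" by (auto simp: irrefl_def adjacency_def)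
    show "\<exists>w. w \<noteq> v \<and> (u, w) \<in> adjacency F" if "(u, v) \<in> adjacency F" for u v
      using that
    proof (cases rule: adjacency_cases)
      case (1 i j)
      then obtain l where "l \<noteq> j" "(i, l) \<in> F"
        using ex_other_nonzero_summand[OF finite_J row, of i j] FE E_subset
        by (auto simp: F_def)
      then show ?thesis using 1 by (intro exI[of _ "Inr l"]) auto
    next
      case (2 i j)
      then obtain k where "k \<noteq> i" "(k, j) \<in> F"
        using ex_other_nonzero_summand[OF _ col, of j i] FE E_subset
        by (auto simp: F_def)
      then show ?thesis using 2 by (intro exI[of _ "Inl k"]) auto
    qed
  qed
  moreover have "adjacency F \<subseteq> adjacency E" using FE by (auto simp: adjacency_def)
  ultimately show False using no_cycle by blast
qed

text \<open>Reversing the sign of the demands at the servers turns a unit flow on an edge into a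
  difference of point masses, so that flows along a path telescope.\<close>

definition achievable :: "(nat + 'j \<Rightarrow> real) \<Rightarrow> bool" where
  "achievable w \<longleftrightarrow> (\<exists>z. (\<forall>i j. (i, j) \<notin> E \<longrightarrow> z i j = 0) \<and>
     (\<forall>j\<in>J. (\<Sum>i<n. z i j) = - w (Inr j)) \<and> (\<forall>i<n. (\<Sum>j\<in>J. z i j) = w (Inl i)))"

lemma achievable_add:
  assumes "achievable v" "achievable w"
  shows "achievable (\<lambda>x. v x + w x)"
proof -
  obtain z z' where "\<forall>i j. (i, j) \<notin> E \<longrightarrow> z i j = 0"
     "(\<forall>j\<in>J. (\<Sum>i<n. z i j) = - v (Inr j)) \<and> (\<forall>i<n. (\<Sum>j\<in>J. z i j) = v (Inl i))"
     "\<forall>i j. (i, j) \<notin> E \<longrightarrow> z' i j = 0"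
     "(\<forall>j\<in>J. (\<Sum>i<n. z' i j) = - w (Inr j)) \<and> (\<forall>i<n. (\<Sum>j\<in>J. z' i j) = w (Inl i))"
    using assms unfolding achievable_def by auto
  then show ?thesis unfolding achievable_def
    by (intro exI[of _ "\<lambda>i j. z i j + z' i j"]) (auto simp: sum.distrib)
qed

lemma achievable_scale:
  assumes "achievable w"
  shows "achievable (\<lambda>x. c * w x)"
proof -
  obtain z where "\<forall>i j. (i, j) \<notin> E \<longrightarrow> z i j = 0"
     "(\<forall>j\<in>J. (\<Sum>i<n. z i j) = - w (Inr j)) \<and> (\<forall>i<n. (\<Sum>j\<in>J. z i j) = w (Inl i))"
    using assms unfolding achievable_def by auto
  then show ?thesis unfolding achievable_def
    by (intro exI[of _ "\<lambda>i j. c * z i j"]) (auto simp flip: sum_distrib_left)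
qed

lemma achievable_0: "achievable (\<lambda>x. 0)"
  unfolding achievable_def by (intro exI[of _ "\<lambda>i j. 0"]) auto

lemma achievable_sum:
  assumes "finite A" "\<And>a. a \<in> A \<Longrightarrow> achievable (f a)"
  shows "achievable (\<lambda>x. \<Sum>a\<in>A. f a x)"
  using assms by (induction A) (auto intro: achievable_0 achievable_add)

lemma achievable_cong:
  assumes "achievable v" "\<And>x. x \<in> Inl ` {..<n} \<union> Inr ` J \<Longrightarrow> v x = w x"
  shows "achievable w"
  using assms unfolding achievable_def by auto

lemma achievable_dipole:
  assumes "(u, v) \<in> (adjacency E)\<^sup>*"
  shows "achievable (\<lambda>x. of_bool (x = u) - of_bool (x = v))"
  using assms
proof (induction rule: rtrancl_induct)
  case base
  then show ?case using achievable_0 by simp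
next
  case (step v w)
  have edge: "achievable (\<lambda>x. of_bool (x = Inl i) - of_bool (x = Inr j))" if "(i, j) \<in> E" for i j
  proof -
    have "i < n" "j \<in> J" using that E_subset by auto
    then show ?thesis unfolding achievable_def
      using that finite_J
      by (intro exI[of _ "\<lambda>k l. of_bool (k = i) * of_bool (l = j)"])
        (auto simp flip: sum_distrib_left sum_distrib_right)
  qed
  have "achievable (\<lambda>x. of_bool (x = v) - of_bool (x = w))"
    using step(2)
  proof (cases rule: adjacency_cases)
    case (1 i j)
    then show ?thesis using edge by simp
  next
    case (2 i j)
    \<comment> \<open>An edge traversed from server to customer carries flow -1.\<close>
    then show ?thesis using achievable_scale[OF edge, of i j "-1"] by simp
  qed
  from achievable_add[OF step.IH this] show ?case by simp
qed

text \<open>The demand \<open>w v\<close> of each vertex is shipped to a fixed root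
  \<open>r\<close>. The resulting combination of dipoles is off only at \<open>r\<close>, by the
  total demand, which is zero by \<open>bal\<close>.\<close>

lemma flow_exists:
  fixes a :: "'j \<Rightarrow> real" and y :: "nat \<Rightarrow> real"
  assumes bal: "sum y {..<n} = sum a J"
  shows "\<exists>z. (\<forall>i j. (i, j) \<notin> E \<longrightarrow> z i j = 0) \<and>
     (\<forall>j\<in>J. (\<Sum>i<n. z i j) = a j) \<and> (\<forall>i<n. (\<Sum>j\<in>J. z i j) = y i)"
proof -
  let ?V = "Inl ` {..<n} \<union> Inr ` J :: (nat + 'j) set"
  define w where "w = case_sum y (\<lambda>j. - a j)"
  have finV: "finite ?V" using finite_J by simp
  have "?V \<noteq> {}" using tree by (simp add: undirected_tree_def)
  then obtain r where r: "r \<in> ?V" by blast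
  have "sum w ?V = sum w (Inl ` {..<n}) + sum w (Inr ` J)"
    using finite_J by (intro sum.union_disjoint) auto
  also have "\<dots> = 0" using bal by (simp add: sum.reindex w_def sum_negf)
  finally have w0: "sum w ?V = 0" .
  have "achievable (\<lambda>x. \<Sum>v\<in>?V. w v * (of_bool (x = v) - of_bool (x = r)))"
    by (intro achievable_sum achievable_scale achievable_dipole finV connected r)
  then have "achievable w"
  proof (rule achievable_cong)
    fix x assume "x \<in> ?V"
    then show "(\<Sum>v\<in>?V. w v * (of_bool (x = v) - of_bool (x = r))) = w x"
      using finV w0
      by (simp add: right_diff_distrib sum_subtractf flip: sum_distrib_right)
  qed
  then show ?thesis unfolding achievable_def w_def by simp
qed

text \<open>This is connectedness of the graph of customers that share a server. Enlarging
  \<open>A\<close> by all its servers ensures that an edge leaving the set runs from a server to a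
  customer outside \<open>A\<close>.\<close>

lemma customer_cut:
  assumes "A \<subseteq> {..<n}" "i \<in> A" "k < n" "k \<notin> A"
  shows "\<exists>a\<in>A. \<exists>b<n. b \<notin> A \<and> (\<exists>j. (a, j) \<in> E \<and> (b, j) \<in> E)"
proof -
  let ?A = "Inl ` A \<union> Inr ` {j. \<exists>a\<in>A. (a, j) \<in> E}"
  have path: "(Inl i, Inl k) \<in> (adjacency E)\<^sup>*" using assms by (intro connected) auto
  have ends: "Inl i \<in> ?A" "Inl k \<notin> ?A" using assms by auto
  obtain x y where xy: "(x, y) \<in> adjacency E" "x \<in> ?A" "y \<notin> ?A"
    using rtrancl_leaves_set[OF path ends] by blast
  from xy(1) show ?thesis
    by (cases rule: adjacency_cases) (use xy E_subset in blast)+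
qed

text \<open>An edge leaving the set formed by \<open>j\<close> and its customers can only run from
  such a customer to another server.\<close>

lemma second_server:
  assumes "j \<in> J" "l \<in> J" "l \<noteq> j"
  shows "\<exists>i m. (i, j) \<in> E \<and> (i, m) \<in> E \<and> m \<noteq> j"
proof -
  let ?A = "insert (Inr j) (Inl ` {i. (i, j) \<in> E})"
  have path: "(Inr j, Inr l) \<in> (adjacency E)\<^sup>*" using assms by (intro connected) auto
  have ends: "Inr j \<in> ?A" "Inr l \<notin> ?A" using assms by auto
  obtain x y where xy: "(x, y) \<in> adjacency E" "x \<in> ?A" "y \<notin> ?A"
    using rtrancl_leaves_set[OF path ends] by blast
  from xy(1) show ?thesis
  proof (cases rule: adjacency_cases)
    case (1 i m)
    then show ?thesis using xy(2,3) by blast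
  next
    case (2 i m)
    then show ?thesis using xy(2,3) by blast
  qed
qed

end

subsection \<open>Matrices with vanishing column sums\<close>

lemma char_poly_four_block_mat_lower_left_zero:
  fixes A1 :: "'a :: idom mat"
  assumes A1: "A1 \<in> carrier_mat n n" and A2: "A2 \<in> carrier_mat n m" and A4: "A4 \<in> carrier_mat m m"
  shows "char_poly (four_block_mat A1 A2 (0\<^sub>m m n) A4) = char_poly A1 * char_poly A4"
    (is "char_poly ?A = _")
proof -
  let ?cm = "\<lambda>A. [:0, 1:] \<cdot>\<^sub>m 1\<^sub>m (dim_row A) + map_mat (\<lambda>a. [:- a:]) A"
  have "char_poly ?A = det (?cm ?A)"
    unfolding char_poly_defs using A1 A4 by simp
  also have "?cm ?A = four_block_mat (?cm A1) (map_mat (\<lambda>a. [:- a:]) A2) (0\<^sub>m m n) (?cm A4)"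
    by (rule eq_matI) (use A1 A2 A4 in \<open>auto simp: one_poly_def\<close>)
  also have "det \<dots> = det (?cm A1) * det (?cm A4)"
    by (rule det_four_block_mat_lower_left_zero[OF _ _ refl]) (use A1 A2 A4 in auto)
  finally show ?thesis unfolding char_poly_defs .
qed

text \<open>On vectors with zero sum the last coordinate is minus the sum of the others, hence the
  subtraction of the last column. If the columns of \<open>A\<close> sum to zero, this is the matrix
  of \<open>A\<close> restricted to that hyperplane.\<close>

definition compression :: "'a :: comm_ring_1 mat \<Rightarrow> 'a mat" where
  "compression A = (let m = dim_row A - 1 in mat m m (\<lambda>(i, k). A $$ (i, k) - A $$ (i, m)))"

text \<open>In the coordinates \<open>y\<^sub>0, \<dots>, y\<^sub>m\<^sub>-\<^sub>1, \<Sum>y\<close> a matrix whose columns sum to zero is block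
  triangular, with last row zero.\<close>

lemma char_poly_compression:
  fixes A :: "'a :: field mat"
  assumes A: "A \<in> carrier_mat n n" and n: "0 < n"
    and col: "\<And>k. k < n \<Longrightarrow> (\<Sum>i<n. A $$ (i, k)) = 0"
  shows "char_poly A = [:0, 1:] * char_poly (compression A)"
proof -
  obtain m where m: "n = Suc m" using n by (cases n) auto
  define B where "B = compression A"
  define C where "C = four_block_mat B (mat m 1 (\<lambda>(i, k). A $$ (i, m))) (0\<^sub>m 1 m) (0\<^sub>m 1 1 :: 'a mat)"
  \<comment> \<open>\<open>P\<close> replaces the last coordinate by the sum of all coordinates, and
    \<open>Q\<close> is its inverse; \<open>C\<close> is the matrix \<open>A\<close> in the new
    coordinates.\<close>
  define P where "P = mat n n (\<lambda>(i, k). if i = m then 1 else of_bool (i = k) :: 'a)"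
  define Q where "Q = mat n n (\<lambda>(i, k). if i = m \<and> k \<noteq> m then -1 else of_bool (i = k) :: 'a)"
  have B: "B \<in> carrier_mat m m" using A by (simp add: B_def compression_def m)
  have C: "C \<in> carrier_mat n n" using four_block_carrier_mat[OF B zero_carrier_mat[of 1 1]] by (simp add: C_def m)
  have PQ: "P \<in> carrier_mat n n" "Q \<in> carrier_mat n n" by (simp_all add: P_def Q_def)
  have entry: "(X * Y) $$ (i, k) = (\<Sum>l<m. X $$ (i, l) * Y $$ (l, k)) + X $$ (i, m) * Y $$ (m, k)"
    if "X \<in> carrier_mat n n" "Y \<in> carrier_mat n n" "i < n" "k < n" for X Y :: "'a mat" and i k
    using that m by (simp add: scalar_prod_def lessThan_atLeast0)
  have QP: "Q * P = 1\<^sub>m n"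
  proof (rule eq_matI)
    show "(Q * P) $$ (i, k) = 1\<^sub>m n $$ (i, k)" if "i < dim_row (1\<^sub>m n)" "k < dim_col (1\<^sub>m n)" for i k
      using that m unfolding entry[OF PQ(2,1) that[simplified]]
      by (cases "i = m"; cases "k = m") (auto simp: P_def Q_def less_Suc_eq sum_negf)
  qed (use PQ in auto)
  have PA: "P * A = C * P"
  proof (rule eq_matI)
    fix i k assume "i < dim_row (C * P)" "k < dim_col (C * P)"
    then have ik: "i < n" "k < n" using C PQ by auto
    have "A $$ (m, k) + (\<Sum>l<m. A $$ (l, k)) = 0"
      using col[OF ik(2)] m by (simp add: add.commute)
    then show "(P * A) $$ (i, k) = (C * P) $$ (i, k)"
      using ik A B unfolding entry[OF PQ(1) A ik] entry[OF C PQ(1) ik] m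
      by (cases "i = m"; cases "k = m")
        (auto simp: P_def C_def m less_Suc_eq B_def compression_def add.commute)
  qed (use A C PQ in auto)
  have "A = (Q * P) * A" using QP A by simp
  also have "\<dots> = Q * (P * A)" using A PQ by simp
  also have "\<dots> = Q * C * P" using C PQ PA by simp
  finally have "similar_mat_wit A C Q P"
    using A C PQ QP mat_mult_left_right_inverse[OF PQ(2,1) QP] by (simp add: similar_mat_wit_def)
  then have "char_poly A = char_poly C"
    by (intro char_poly_similar) (auto simp: similar_mat_def)
  also have "\<dots> = char_poly B * char_poly (0\<^sub>m 1 1 :: 'a mat)"
    unfolding C_def using B by (intro char_poly_four_block_mat_lower_left_zero) auto
  also have "char_poly (0\<^sub>m 1 1 :: 'a mat) = [:0, 1:]"
    by (simp add: char_poly_defs det_def)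
  finally show ?thesis by (simp only: B_def mult.commute)
qed

lemma eigenvalue_compression_iff:
  fixes A :: "'a :: field mat"
  assumes A: "A \<in> carrier_mat n n" and n: "0 < n"
    and col: "\<And>k. k < n \<Longrightarrow> (\<Sum>i<n. A $$ (i, k)) = 0"
  shows "eigenvalue (compression A) e \<longleftrightarrow>
    (\<exists>y. (\<exists>k<n. y k \<noteq> 0) \<and> (\<Sum>k<n. y k) = 0 \<and> (\<forall>i<n. (\<Sum>k<n. A $$ (i, k) * y k) = e * y i))"
    (is "_ \<longleftrightarrow> (\<exists>y. ?Q y)")
proof -
  obtain m where m: "n = Suc m" using n by (cases n) auto
  have dim: "dim_row (compression A) = m" "dim_col (compression A) = m"
    using A m by (auto simp: compression_def)
  have mult: "(compression A *\<^sub>v v) $ i = (\<Sum>k<n. A $$ (i, k) * y k)"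
    if "v \<in> carrier_vec m" "\<And>k. k < m \<Longrightarrow> v $ k = y k" "(\<Sum>k<n. y k) = 0" "i < m" for v y i
  proof -
    have "(compression A *\<^sub>v v) $ i = (\<Sum>k<m. (A $$ (i, k) - A $$ (i, m)) * y k)"
      using that A m by (auto simp: compression_def scalar_prod_def lessThan_atLeast0 intro!: sum.cong)
    also have "\<dots> = (\<Sum>k<m. A $$ (i, k) * y k) - A $$ (i, m) * (\<Sum>k<m. y k)"
      by (simp add: left_diff_distrib sum_subtractf sum_distrib_left)
    also have "(\<Sum>k<m. y k) = - y m"
      using that(3) m by (simp add: eq_neg_iff_add_eq_0)
    finally show ?thesis by (simp add: m)
  qed
  show ?thesis
  proof
    assume "eigenvalue (compression A) e"
    then obtain v where v: "v \<in> carrier_vec m" "v \<noteq> 0\<^sub>v m" "compression A *\<^sub>v v = e \<cdot>\<^sub>v v"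
      by (auto simp: eigenvalue_def eigenvector_def dim)
    define y where "y k = (if k = m then - (\<Sum>k<m. v $ k) else v $ k)" for k
    have y0: "(\<Sum>k<n. y k) = 0" by (simp add: y_def m)
    have low: "(\<Sum>k<n. A $$ (i, k) * y k) = e * y i" if "i < m" for i
      using mult[OF v(1) _ y0 that] v(1,3) that by (simp add: y_def)
    \<comment> \<open>The compression sees only the first \<open>m\<close> rows. The last row of the
      eigenvalue equation follows because both of its sides sum to zero over all rows.\<close>
    have "(\<Sum>i<n. \<Sum>k<n. A $$ (i, k) * y k) = (\<Sum>k<n. (\<Sum>i<n. A $$ (i, k)) * y k)"
      by (subst sum.swap) (simp add: sum_distrib_right)
    also have "\<dots> = 0" by (simp add: col)
    finally have "(\<Sum>i<m. e * y i) + (\<Sum>k<n. A $$ (m, k) * y k) = 0"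
      using low by (simp add: m)
    moreover have "(\<Sum>i<m. e * y i) + e * y m = 0"
      using y0 by (simp add: m flip: sum_distrib_left distrib_left)
    ultimately have "(\<Sum>k<n. A $$ (m, k) * y k) = e * y m" by (metis add_left_cancel)
    with low have "\<forall>i<n. (\<Sum>k<n. A $$ (i, k) * y k) = e * y i" by (auto simp: m less_Suc_eq)
    moreover have "\<exists>k<n. y k \<noteq> 0"
    proof -
      obtain k where "k < m" "v $ k \<noteq> 0" using v(1,2) by (metis eq_vecI carrier_vecD index_zero_vec)
      then show ?thesis by (intro exI[of _ k]) (auto simp: y_def m)
    qed
    ultimately show "\<exists>y. ?Q y" using y0 by blast
  next
    assume "\<exists>y. ?Q y"
    then obtain y where y: "?Q y" by blast
    define v where "v = vec m y"
    have v: "v \<in> carrier_vec m" by (simp add: v_def)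
    have "compression A *\<^sub>v v = e \<cdot>\<^sub>v v"
      by (rule eq_vecI) (use y mult[OF v, of y] dim in \<open>auto simp: v_def m\<close>)
    moreover have "v \<noteq> 0\<^sub>v m"
    proof
      assume "v = 0\<^sub>v m"
      then have "y k = 0" if "k < m" for k using that by (metis index_vec index_zero_vec(1) v_def)
      then show False using y by (auto simp: m less_Suc_eq)
    qed
    ultimately show "eigenvalue (compression A) e"
      using v by (auto simp: eigenvalue_def eigenvector_def dim)
  qed
qed

text \<open>With the factor X split off, 0 is a simple root exactly if it is no root of the
  remaining factor. Since 0 does not have negative real part, this merges with the condition on the
  other eigenvalues.\<close>

lemma order_char_poly_compression_iff:
  fixes A :: "complex mat"
  assumes A: "A \<in> carrier_mat n n" and n: "0 < n"
    and col: "\<And>k. k < n \<Longrightarrow> (\<Sum>i<n. A $$ (i, k)) = 0"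
  shows "Polynomial.order 0 (char_poly A) = 1 \<and> (\<forall>e. eigenvalue A e \<and> e \<noteq> 0 \<longrightarrow> Re e < 0) \<longleftrightarrow>
    (\<forall>e. eigenvalue (compression A) e \<longrightarrow> Re e < 0)"
proof -
  let ?q = "char_poly (compression A)"
  have B: "compression A \<in> carrier_mat (n - 1) (n - 1)" using A by (simp add: compression_def Let_def)
  have cp: "char_poly A = [:0, 1:] * ?q" by (rule char_poly_compression[OF A n col])
  have q: "?q \<noteq> 0" using degree_monic_char_poly[OF B] by auto
  have "Polynomial.order 0 (char_poly A) = Polynomial.order 0 [:0, 1 :: complex:] + Polynomial.order 0 ?q"
    unfolding cp by (rule order_mult) (use q in auto)
  moreover have "Polynomial.order 0 [:0, 1 :: complex:] = 1"
    using order_power_n_n[of 0 1] by simp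
  ultimately have "Polynomial.order 0 (char_poly A) = 1 \<longleftrightarrow> poly ?q 0 \<noteq> 0"
    using order_root[of ?q 0] q by auto
  moreover have "eigenvalue A e \<longleftrightarrow> e = 0 \<or> eigenvalue (compression A) e" for e
    unfolding eigenvalue_root_char_poly[OF A] eigenvalue_root_char_poly[OF B] cp by simp
  ultimately show ?thesis
    using eigenvalue_root_char_poly[OF B, of 0] by (metis less_irrefl zero_complex.sel(1))
qed

subsection \<open>Critically loaded systems and their modes\<close>

lemma critically_loadedD:
  assumes "critically_loaded S"
  shows "spp_feasible S (fst (spp_solution S)) 1"
    and "spp_feasible S l r \<Longrightarrow> 1 \<le> r"
    and "spp_feasible S l 1 \<Longrightarrow> l = fst (spp_solution S)"
proof -
  have ex1: "\<exists>!p. spp_optimal S p" and one: "snd (spp_solution S) = 1"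
    using assms by (auto simp: critically_loaded_def complete_resource_pooling_def)
  have opt: "spp_optimal S (spp_solution S)"
    using theI'[OF ex1] by (simp add: spp_solution_def)
  then show "spp_feasible S (fst (spp_solution S)) 1" using one by (simp add: spp_optimal_def)
  show le: "1 \<le> r" if "spp_feasible S l r" for l r using opt that one by (auto simp: spp_optimal_def)
  show "l = fst (spp_solution S)" if "spp_feasible S l 1"
  proof -
    have "spp_optimal S (l, 1)" using that le by (simp add: spp_optimal_def)
    then show ?thesis using ex1 opt by (metis fst_conv)
  qed
qed

lemma spp_solution_eqI:
  assumes "spp_feasible S l 1"
    and uniq: "\<And>l' r'. spp_feasible S l' r' \<Longrightarrow> r' \<le> 1 \<Longrightarrow> l' = l \<and> r' = 1"
  shows "\<exists>!p. spp_optimal S p" "spp_solution S = (l, 1)"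
proof -
  have opt: "spp_optimal S (l, 1)"
    using assms unfolding spp_optimal_def by (metis fst_conv linear snd_conv)
  moreover have "p = (l, 1)" if "spp_optimal S p" for p
    using that opt uniq[of "fst p" "snd p"] by (cases p) (auto simp: spp_optimal_def)
  ultimately show "\<exists>!p. spp_optimal S p" "spp_solution S = (l, 1)"
    unfolding spp_solution_def by blast+
qed

lemma bipartite_tree_basic_activities:
  assumes "critically_loaded S"
  shows "bipartite_tree (ncust S) (servers S) (basic_activities S)"
  using assms
  by unfold_locales
    (auto simp: critically_loaded_def valid_system_def complete_resource_pooling_def basic_activities_def)

lemma srate_basic_pos:
  assumes "critically_loaded S" "(i, j) \<in> basic_activities S"
  shows "0 < srate S i j"
proof -
  have "srate S i j \<noteq> 0"
    using critically_loadedD(1)[OF assms(1)] assms(2)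
    by (fastforce simp: spp_feasible_def basic_activities_def)
  then show ?thesis
    using assms by (force simp: critically_loaded_def valid_system_def basic_activities_def)
qed

lemma ex_other_element:
  assumes "2 \<le> card A"
  shows "\<exists>b\<in>A. b \<noteq> a"
proof (rule ccontr)
  assume "\<not> ?thesis"
  then have "A \<subseteq> {a}" by blast
  then have "card A \<le> card {a}" by (intro card_mono) auto
  with assms show False by simp
qed

text \<open>A server with spare capacity could take over flow from a neighbouring one, which would
  contradict the uniqueness of the optimal solution.\<close>

lemma full_load:
  assumes crit: "critically_loaded S" and j: "j \<in> servers S" and card: "2 \<le> card (servers S)"
  shows "(\<Sum>i<ncust S. fst (spp_solution S) i j / (pool S j * srate S i j)) = 1"
proof (rule ccontr)
  interpret bipartite_tree "ncust S" "servers S" "basic_activities S"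
    by (rule bipartite_tree_basic_activities[OF crit])
  define L where "L = fst (spp_solution S)"
  define load where "load s = (\<Sum>i<ncust S. L i s / (pool S s * srate S i s))" for s
  have feas: "spp_feasible S L 1" unfolding L_def by (rule critically_loadedD[OF crit])
  assume "\<not> ?thesis"
  then have slack: "load j < 1"
    using feas j by (fastforce simp: spp_feasible_def load_def L_def)
  have "\<exists>l\<in>servers S. l \<noteq> j" by (rule ex_other_element[OF card])
  then obtain i m where im: "(i, j) \<in> basic_activities S" "(i, m) \<in> basic_activities S" "m \<noteq> j"
    using second_server[OF j] by blast
  have i: "i < ncust S" and m: "m \<in> servers S" "0 < L i m"
    using im by (auto simp: basic_activities_def L_def)
  have \<mu>: "0 < srate S i j" "0 < srate S i m" using srate_basic_pos[OF crit] im by auto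
  have \<beta>: "0 < pool S j" "0 < pool S m"
    using crit j m by (auto simp: critically_loaded_def valid_system_def)
  \<comment> \<open>The amount of type \<open>i\<close> moved from \<open>m\<close> to
    \<open>j\<close>: bounded by the flow present at \<open>m\<close> and by what the spare capacity
    of \<open>j\<close> can absorb.\<close>
  define \<epsilon> where "\<epsilon> = min (L i m) ((1 - load j) * (pool S j * srate S i j))"
  have \<epsilon>: "0 < \<epsilon>" "\<epsilon> \<le> L i m" "\<epsilon> / (pool S j * srate S i j) \<le> 1 - load j"
    using slack \<mu> \<beta> m by (auto simp: \<epsilon>_def field_simps min_def)
  define l where "l k s = L k s + (if k = i then if s = j then \<epsilon> else if s = m then - \<epsilon> else 0 else 0)" for k s
  have row: "(\<Sum>s\<in>servers S. l k s) = arrival S k" if "k < ncust S" for k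
  proof -
    have "(\<Sum>s\<in>servers S. if s = j then \<epsilon> else if s = m then - \<epsilon> else 0) =
      (\<Sum>s\<in>servers S. if s = j then \<epsilon> else 0) + (\<Sum>s\<in>servers S. if s = m then - \<epsilon> else 0)"
      unfolding sum.distrib[symmetric] using im(3) by (intro sum.cong) auto
    also have "\<dots> = 0" using finite_J j m by simp
    finally show ?thesis using feas that
      by (cases "k = i") (auto simp: l_def sum.distrib spp_feasible_def)
  qed
  have load: "(\<Sum>k<ncust S. l k s / (pool S s * srate S k s)) =
      load s + (if s = j then \<epsilon> else if s = m then - \<epsilon> else 0) / (pool S s * srate S i s)" for s
  proof -
    have "(\<Sum>k<ncust S. l k s / (pool S s * srate S k s)) = (\<Sum>k<ncust S.
        L k s / (pool S s * srate S k s) +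
        (if k = i then (if s = j then \<epsilon> else if s = m then - \<epsilon> else 0) / (pool S s * srate S i s) else 0))"
      unfolding l_def by (intro sum.cong) (auto simp: add_divide_distrib diff_divide_distrib)
    then show ?thesis using i by (simp add: sum.distrib load_def)
  qed
  have "spp_feasible S l 1"
    unfolding spp_feasible_def
  proof (intro conjI allI ballI impI)
    show "0 \<le> l k s" for k s using feas \<epsilon> by (auto simp: l_def spp_feasible_def)
    show "l k s = 0" if "\<not> (k < ncust S \<and> s \<in> servers S \<and> srate S k s \<noteq> 0)" for k s
      using that feas i j m \<mu> by (auto simp: l_def spp_feasible_def)
    show "(\<Sum>k<ncust S. l k s / (pool S s * srate S k s)) \<le> 1" if "s \<in> servers S" for s
    proof -
      have "load s \<le> 1" using feas that by (simp add: spp_feasible_def load_def)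
      moreover have "0 \<le> \<epsilon> / (pool S m * srate S i m)" using \<epsilon> \<mu> \<beta> by simp
      ultimately show ?thesis unfolding load using \<epsilon>(3) im(3) by auto
    qed
  qed (rule row)
  then have "l = L" unfolding L_def by (rule critically_loadedD[OF crit])
  then have "l i j = L i j" by simp
  then show False using \<epsilon> by (simp add: l_def)
qed

section \<open>The flow map on unit vectors\<close>

lemma sum_custs_of:
  assumes "\<And>i. (i, j) \<notin> basic_activities S \<Longrightarrow> f i = 0"
  shows "sum f (custs_of S j) = sum f {..<ncust S}"
  using assms by (intro sum.mono_neutral_left) (auto simp: custs_of_def basic_activities_def)

lemma sum_servers_of:
  assumes "finite (servers S)" "\<And>j. (i, j) \<notin> basic_activities S \<Longrightarrow> f j = 0"
  shows "sum f (servers_of S i) = sum f (servers S)"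
  using assms by (intro sum.mono_neutral_left) (auto simp: servers_of_def basic_activities_def)

text \<open>The description operator in \<open>M_map\<close> needs existence, from
  \<open>flow_exists\<close> with total demand 1 on both sides, and uniqueness, from
  \<open>circulation_eq_0\<close>. Unit vectors suffice, since they give the columns of
  \<open>A_u\<close>. Sums over neighbours become sums over all indices because the flow vanishes
  off the basic activities.\<close>

lemma M_map_unit_vec:
  assumes crit: "critically_loaded S" and k: "k < ncust S"
  defines "z \<equiv> M_map S (unit_vec (ncust S) k)"
  shows "(i, j) \<notin> basic_activities S \<Longrightarrow> z i j = 0"
    and "j \<in> servers S \<Longrightarrow> (\<Sum>i<ncust S. z i j) = pool S j / sum (pool S) (servers S)"
    and "i < ncust S \<Longrightarrow> (\<Sum>j\<in>servers S. z i j) = of_bool (i = k)"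
proof -
  interpret bipartite_tree "ncust S" "servers S" "basic_activities S"
    by (rule bipartite_tree_basic_activities[OF crit])
  let ?P = "\<lambda>z. (\<forall>i j. (i, j) \<notin> basic_activities S \<longrightarrow> z i j = 0) \<and>
     (\<forall>j\<in>servers S. (\<Sum>i<ncust S. z i j) = pool S j / sum (pool S) (servers S)) \<and>
     (\<forall>i<ncust S. (\<Sum>j\<in>servers S. z i j) = of_bool (i = k))"
  let ?Q = "\<lambda>z. (\<forall>i j. (i, j) \<notin> basic_activities S \<longrightarrow> z i j = 0) \<and>
     (\<forall>j\<in>servers S. (\<Sum>i\<in>custs_of S j. z i j) =
        (\<Sum>i<ncust S. unit_vec (ncust S) k $ i) / (\<Sum>j\<in>servers S. pool S j) * pool S j) \<and>
     (\<forall>i<ncust S. (\<Sum>j\<in>servers_of S i. z i j) = unit_vec (ncust S) k $ i)"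
  have pos: "0 < sum (pool S) (servers S)"
    using crit by (intro sum_pos) (auto simp: critically_loaded_def valid_system_def)
  have unit: "unit_vec (ncust S) k $ i = (of_bool (i = k) :: real)" if "i < ncust S" for i
    using that k by (simp add: unit_vec_def)
  have unit_sum: "(\<Sum>i<ncust S. unit_vec (ncust S) k $ i) = (1 :: real)"
    using k by (simp add: unit cong: sum.cong_simp)
  have QP: "?Q z \<longleftrightarrow> ?P z" for z
  proof (cases "\<forall>i j. (i, j) \<notin> basic_activities S \<longrightarrow> z i j = 0")
    case True
    then have "sum (\<lambda>i. z i j) (custs_of S j) = (\<Sum>i<ncust S. z i j)" for j
      by (intro sum_custs_of) auto
    moreover have "sum (z i) (servers_of S i) = sum (z i) (servers S)" for i
      using True finite_J by (intro sum_servers_of) auto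
    ultimately show ?thesis unfolding unit_sum by (simp add: unit)
  qed auto
  have "(\<Sum>i<ncust S. of_bool (i = k)) = (\<Sum>j\<in>servers S. pool S j / sum (pool S) (servers S))"
    using pos k by (simp flip: sum_divide_distrib)
  from flow_exists[OF this] obtain z0 where z0: "?P z0" by blast
  have uniq: "z' = z0" if z': "?P z'" for z'
  proof (intro ext)
    fix i j
    have "z' i j - z0 i j = 0"
      by (rule circulation_eq_0[of "\<lambda>i j. z' i j - z0 i j"]) (use z0 z' in \<open>auto simp: sum_subtractf\<close>)
    then show "z' i j = z0 i j" by simp
  qed
  have "z = z0"
    unfolding z_def M_map_def
  proof (rule the_equality)
    show "?Q z0" using z0 by (subst QP)
    show "z' = z0" if "?Q z'" for z'
      by (rule uniq) (subst QP[symmetric], fact that)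
  qed
  with z0 show "(i, j) \<notin> basic_activities S \<Longrightarrow> z i j = 0"
    and "j \<in> servers S \<Longrightarrow> (\<Sum>i<ncust S. z i j) = pool S j / sum (pool S) (servers S)"
    and "i < ncust S \<Longrightarrow> (\<Sum>j\<in>servers S. z i j) = of_bool (i = k)"
    by auto
qed

text \<open>The eigenvectors \<open>y = (\<Sum>\<^sub>j z\<^sub>i\<^sub>j)\<^sub>i\<close> of \<open>A\<^sub>c\<close> with \<open>\<Sum> y = 0\<close>, expressed by the flow
  \<open>z = M y\<close>; this formulation no longer refers to the pool sizes.\<close>

definition mode :: "'j system \<Rightarrow> complex \<Rightarrow> (nat \<Rightarrow> 'j \<Rightarrow> complex) \<Rightarrow> bool" where
  "mode S e z \<longleftrightarrow>
     (\<forall>i j. (i, j) \<notin> basic_activities S \<longrightarrow> z i j = 0) \<and>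
     (\<forall>j\<in>servers S. (\<Sum>i<ncust S. z i j) = 0) \<and>
     (\<exists>t. \<forall>i<ncust S. (\<Sum>j\<in>servers S. (e + of_real (srate S i j)) * z i j) = t)"

text \<open>Row \<open>i\<close> of \<open>A_c\<close> applied to \<open>y\<close> is the mean of
  the service-weighted row sums of the flow minus the \<open>i\<close>-th one. The eigenvalue
  equation therefore says that \<open>e * y i\<close> plus the \<open>i\<close>-th weighted sum is
  the same for all \<open>i\<close>.\<close>

lemma locally_stable_iff_mode:
  assumes crit: "critically_loaded S"
  shows "locally_stable S \<longleftrightarrow> (\<forall>e z. mode S e z \<and> 0 \<le> Re e \<longrightarrow> (\<forall>i j. z i j = 0))"
proof -
  interpret bipartite_tree "ncust S" "servers S" "basic_activities S"
    by (rule bipartite_tree_basic_activities[OF crit])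
  define n where "n = ncust S"
  have n: "0 < n" using crit by (simp add: n_def critically_loaded_def valid_system_def)
  define A where "A = map_mat complex_of_real (A_c S)"
  have A: "A \<in> carrier_mat n n" by (simp add: A_def A_c_def n_def)
  define M where "M k = M_map S (unit_vec n k)" for k
  note M = M_map_unit_vec[OF crit, folded n_def, folded M_def]
  have Au: "A_u S $$ (i, k) = - (\<Sum>j\<in>servers S. srate S i j * M k i j)" if "i < n" "k < n" for i k
  proof -
    have "(\<Sum>j\<in>servers_of S i. srate S i j * M k i j) = (\<Sum>j\<in>servers S. srate S i j * M k i j)"
      using M(1) that finite_J by (intro sum_servers_of) auto
    then show ?thesis using that by (simp add: A_u_def n_def M_def)
  qed
  have Ac: "A $$ (i, k) = of_real (A_u S $$ (i, k)) - of_real (\<Sum>l<n. A_u S $$ (l, k)) / of_nat n"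
    if "i < n" "k < n" for i k
    using that by (simp add: A_def A_c_def n_def)
  have col: "(\<Sum>i<n. A $$ (i, k)) = 0" if "k < n" for k
    using that n by (simp add: Ac sum_subtractf cong: sum.cong_simp)
  \<comment> \<open>\<open>Z\<close> extends \<open>M_map\<close> complex-linearly from the unit
    vectors, and \<open>w (Z y)\<close> is the negative of \<open>A_u\<close> applied to
    \<open>y\<close> (see \<open>Au_Z\<close>).\<close>
  define Z where "Z y i j = (\<Sum>k<n. y k * of_real (M k i j))" for y :: "nat \<Rightarrow> complex" and i j
  define w where "w z i = (\<Sum>j\<in>servers S. of_real (srate S i j) * z i j)" for z :: "nat \<Rightarrow> 'a \<Rightarrow> complex" and i
  have Z_supp: "Z y i j = 0" if "(i, j) \<notin> basic_activities S" for y i j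
    using that M(1) by (simp add: Z_def)
  have Z_col: "(\<Sum>i<n. Z y i j) = 0" if "(\<Sum>k<n. y k) = 0" "j \<in> servers S" for y j
  proof -
    have "(\<Sum>i<n. Z y i j) = (\<Sum>k<n. y k * of_real (\<Sum>i<n. M k i j))"
      unfolding Z_def by (subst sum.swap) (simp add: sum_distrib_left)
    also have "\<dots> = (\<Sum>k<n. y k * of_real (pool S j / sum (pool S) (servers S)))"
      using M(2) that by (intro sum.cong) auto
    also have "\<dots> = (\<Sum>k<n. y k) * of_real (pool S j / sum (pool S) (servers S))"
      by (rule sum_distrib_right[symmetric])
    finally show ?thesis using that by simp
  qed
  have Z_row: "(\<Sum>j\<in>servers S. Z y i j) = y i" if "i < n" for y i
  proof -
    have "(\<Sum>j\<in>servers S. Z y i j) = (\<Sum>k<n. y k * of_real (\<Sum>j\<in>servers S. M k i j))"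
      unfolding Z_def by (subst sum.swap) (simp add: sum_distrib_left)
    also have "\<dots> = (\<Sum>k<n. y k * of_bool (i = k))"
      using M(3) that by (intro sum.cong) auto
    finally show ?thesis using that by simp
  qed
  have Au_Z: "(\<Sum>k<n. of_real (A_u S $$ (i, k)) * y k) = - w (Z y) i" if "i < n" for y i
  proof -
    have "w (Z y) i = (\<Sum>j\<in>servers S. \<Sum>k<n. of_real (srate S i j * M k i j) * y k)"
      unfolding w_def Z_def by (simp add: sum_distrib_left mult_ac)
    also have "\<dots> = (\<Sum>k<n. of_real (\<Sum>j\<in>servers S. srate S i j * M k i j) * y k)"
      by (subst sum.swap) (simp add: sum_distrib_right)
    also have "\<dots> = - (\<Sum>k<n. of_real (A_u S $$ (i, k)) * y k)"
      using that by (simp add: Au sum_negf cong: sum.cong_simp)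
    finally show ?thesis by simp
  qed
  have A_Z: "(\<Sum>k<n. A $$ (i, k) * y k) = (\<Sum>l<n. w (Z y) l) / of_nat n - w (Z y) i" if "i < n" for y i
  proof -
    have "(\<Sum>k<n. A $$ (i, k) * y k) =
       (\<Sum>k<n. of_real (A_u S $$ (i, k)) * y k) - (\<Sum>k<n. \<Sum>l<n. of_real (A_u S $$ (l, k)) * y k) / of_nat n"
      using that
      by (simp add: Ac left_diff_distrib sum_subtractf sum_divide_distrib sum_distrib_right cong: sum.cong_simp)
    also have "(\<Sum>k<n. \<Sum>l<n. of_real (A_u S $$ (l, k)) * y k) = - (\<Sum>l<n. w (Z y) l)"
      by (subst sum.swap) (simp add: Au_Z sum_negf cong: sum.cong_simp)
    finally show ?thesis using Au_Z[OF that] by simp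
  qed
  have split: "(\<Sum>j\<in>servers S. (e + of_real (srate S i j)) * z i j) = e * (\<Sum>j\<in>servers S. z i j) + w z i"
    for e z i by (simp add: w_def distrib_right sum.distrib sum_distrib_left)
  have ev: "eigenvalue (compression A) e \<longleftrightarrow>
      (\<exists>y. (\<exists>k<n. y k \<noteq> 0) \<and> (\<Sum>k<n. y k) = 0 \<and> (\<forall>i<n. (\<Sum>k<n. A $$ (i, k) * y k) = e * y i))"
    for e by (rule eigenvalue_compression_iff[OF A n col])
  have modes: "eigenvalue (compression A) e \<longleftrightarrow> (\<exists>z. mode S e z \<and> (\<exists>i j. z i j \<noteq> 0))" (is "?L \<longleftrightarrow> ?R") for e
  proof
    assume ?L
    then obtain y where y: "\<exists>k<n. y k \<noteq> 0" "(\<Sum>k<n. y k) = 0"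
      "\<And>i. i < n \<Longrightarrow> (\<Sum>k<n. A $$ (i, k) * y k) = e * y i"
      unfolding ev by blast
    have "\<forall>i<n. e * (\<Sum>j\<in>servers S. Z y i j) + w (Z y) i = (\<Sum>l<n. w (Z y) l) / of_nat n"
    proof (intro allI impI)
      fix i assume "i < n"
      from A_Z[OF this, of y] y(3)[OF this] Z_row[OF this, of y]
      show "e * (\<Sum>j\<in>servers S. Z y i j) + w (Z y) i = (\<Sum>l<n. w (Z y) l) / of_nat n" by simp
    qed
    then have "mode S e (Z y)"
      unfolding mode_def split n_def[symmetric] using Z_supp Z_col[OF y(2)] by blast
    moreover have "\<exists>i j. Z y i j \<noteq> 0"
    proof (rule ccontr)
      assume "\<not> ?thesis"
      then have "(\<Sum>j\<in>servers S. Z y i j) = 0" for i by simp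
      then show False using y(1) Z_row[of _ y] by auto
    qed
    ultimately show ?R by blast
  next
    assume ?R
    then obtain z t where z: "\<And>i j. (i, j) \<notin> basic_activities S \<Longrightarrow> z i j = 0"
      "\<And>j. j \<in> servers S \<Longrightarrow> (\<Sum>i<n. z i j) = 0" "\<exists>i j. z i j \<noteq> 0"
      "\<And>i. i < n \<Longrightarrow> e * (\<Sum>j\<in>servers S. z i j) + w z i = t"
      unfolding mode_def split n_def[symmetric] by blast
    define y where "y i = (\<Sum>j\<in>servers S. z i j)" for i
    have y0: "(\<Sum>i<n. y i) = 0" unfolding y_def by (subst sum.swap) (simp add: z(2))
    have Zr: "(\<Sum>j\<in>servers S. Z y i j) = (\<Sum>j\<in>servers S. z i j)" if "i < n" for i
      using Z_row[OF that] by (simp add: y_def)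
    \<comment> \<open>Both flows have the same row and column sums, so their difference is a
      circulation.\<close>
    have zZ: "z = Z y"
    proof (intro ext)
      fix i j
      have "z i j - Z y i j = 0"
        by (rule circulation_eq_0[of "\<lambda>i j. z i j - Z y i j"])
          (use z(1,2) Z_supp Z_col[OF y0] Zr in \<open>auto simp: sum_subtractf n_def\<close>)
      then show "z i j = Z y i j" by simp
    qed
    \<comment> \<open>Summation over the customers identifies the unspecified \<open>t\<close> as
      the mean of \<open>w z\<close>, since \<open>y\<close> has zero sum.\<close>
    have "(\<Sum>i<n. e * y i + w z i) = of_nat n * t" using z(4) by (simp add: y_def)
    moreover have "(\<Sum>i<n. e * y i) = 0" using y0 by (simp flip: sum_distrib_left)
    ultimately have t: "(\<Sum>i<n. w z i) / of_nat n = t" using n by (simp add: sum.distrib)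
    have "(\<Sum>k<n. A $$ (i, k) * y k) = e * y i" if "i < n" for i
    proof -
      have "(\<Sum>k<n. A $$ (i, k) * y k) = t - w z i"
        using A_Z[OF that, of y] unfolding zZ[symmetric] t .
      also have "\<dots> = e * y i" unfolding z(4)[OF that, symmetric] y_def by simp
      finally show ?thesis .
    qed
    moreover have "\<exists>k<n. y k \<noteq> 0"
    proof (rule ccontr)
      assume "\<not> ?thesis"
      then have "Z y i j = 0" for i j by (simp add: Z_def)
      then show False using z(3) unfolding zZ[symmetric] by simp
    qed
    ultimately show ?L unfolding ev using y0 by blast
  qed
  have stable: "locally_stable S \<longleftrightarrow> (\<forall>e. eigenvalue (compression A) e \<longrightarrow> Re e < 0)"
    unfolding locally_stable_def Let_def A_def[symmetric]
    by (rule order_char_poly_compression_iff[OF A n col])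
  define nonzero where "nonzero z \<longleftrightarrow> (\<exists>i j. z i j \<noteq> 0)" for z :: "nat \<Rightarrow> 'a \<Rightarrow> complex"
  have zero: "(\<forall>i j. z i j = 0) \<longleftrightarrow> \<not> nonzero z" for z by (simp add: nonzero_def)
  show ?thesis
    unfolding stable modes zero nonzero_def[symmetric] not_le[symmetric] by blast
qed

subsection \<open>Removing a leaf\<close>

lemma rtrancl_map_subset:
  assumes "(u, v) \<in> R\<^sup>*" and "\<And>x y. (x, y) \<in> R \<Longrightarrow> (f x, f y) \<in> R'\<^sup>*"
  shows "(f u, f v) \<in> R'\<^sup>*"
  using assms(1)
proof (induction rule: rtrancl_induct)
  case (step y z)
  then show ?case using assms(2) by (blast intro: rtrancl_trans)
qed simp

text \<open>Contracting the leaf \<open>j\<close> onto its neighbour \<open>i\<close> turns every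
  walk into a walk in the smaller graph, the edge between them becoming a trivial step. Deleting an
  edge creates no cycle.\<close>

lemma undirected_tree_remove_leaf:
  assumes tree: "undirected_tree (Inl ` {..<n} \<union> Inr ` J) (adjacency E)"
    and leaf: "\<And>k. (k, j) \<in> E \<longleftrightarrow> k = i" and n: "0 < n"
  shows "undirected_tree (Inl ` {..<n} \<union> Inr ` (J - {j})) (adjacency (E - {(i, j)}))"
  unfolding undirected_tree_def
proof (intro conjI ballI)
  let ?E = "E - {(i, j)}"
  show "Inl ` {..<n} \<union> Inr ` (J - {j}) \<noteq> {}" using n by auto
  have sub: "adjacency ?E \<subseteq> adjacency E" by (auto simp: adjacency_def)
  show "\<not> (\<exists>c. 3 \<le> length c \<and> distinct c \<and>
            (\<forall>k<length c. (c ! k, c ! (Suc k mod length c)) \<in> adjacency ?E))"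
    using tree sub unfolding undirected_tree_def by blast
  fix u v assume uv: "u \<in> Inl ` {..<n} \<union> Inr ` (J - {j})" "v \<in> Inl ` {..<n} \<union> Inr ` (J - {j})"
  define f where "f x = (if x = Inr j then Inl i else x)" for x :: "nat + 'a"
  have "(u, v) \<in> (adjacency E)\<^sup>*" using tree uv unfolding undirected_tree_def by blast
  then have "(f u, f v) \<in> (adjacency ?E)\<^sup>*"
  proof (rule rtrancl_map_subset)
    show "(f x, f y) \<in> (adjacency ?E)\<^sup>*" if "(x, y) \<in> adjacency E" for x y
      using that
    proof (cases rule: adjacency_cases)
      case (1 k l)
      then show ?thesis using leaf by (cases "l = j") (auto simp: f_def)
    next
      case (2 k l)
      then show ?thesis using leaf by (cases "l = j") (auto simp: f_def)
    qed
  qed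
  moreover have "f u = u" "f v = v" using uv by (auto simp: f_def)
  ultimately show "(u, v) \<in> (adjacency ?E)\<^sup>*" by simp
qed

lemma remove_leaf_simps [simp]:
  "ncust (remove_leaf S i j) = ncust S" "servers (remove_leaf S i j) = servers S - {j}"
  "arrival (remove_leaf S i j) = (arrival S)(i := arrival S i - pool S j * srate S i j)"
  "pool (remove_leaf S i j) = pool S" "srate (remove_leaf S i j) = srate S"
  by (simp_all add: remove_leaf_def)

text \<open>By \<open>full_load\<close> the optimum sends exactly
  \<open>pool S j * srate S i j\<close> along the leaf edge. Restricting the optimum and extending
  feasible flows by this amount thus pass between the two planning problems, and uniqueness carries
  over.\<close>

lemma remove_leaf_critically_loaded:
  assumes crit: "critically_loaded S" and card: "2 \<le> card (servers S)" and j: "j \<in> servers S"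
    and leaf: "\<And>k. (k, j) \<in> basic_activities S \<longleftrightarrow> k = i"
  shows "critically_loaded (remove_leaf S i j)" (is "critically_loaded ?S")
    and "basic_activities (remove_leaf S i j) = basic_activities S - {(i, j)}"
proof -
  interpret bipartite_tree "ncust S" "servers S" "basic_activities S"
    by (rule bipartite_tree_basic_activities[OF crit])
  define L where "L = fst (spp_solution S)"
  have feas: "spp_feasible S L 1" unfolding L_def by (rule critically_loadedD[OF crit])
  have basic: "(k, s) \<in> basic_activities S \<longleftrightarrow> k < ncust S \<and> s \<in> servers S \<and> 0 < L k s" for k s
    by (simp add: basic_activities_def L_def)
  have i: "i < ncust S" "0 < L i j" using leaf[of i] basic by auto
  have "\<exists>l\<in>servers S. l \<noteq> j" by (rule ex_other_element[OF card])
  then obtain l m where m: "l \<in> servers S" "l \<noteq> j" "(i, m) \<in> basic_activities S" "m \<noteq> j"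
    using second_server[OF j] leaf by metis
  have \<mu>: "0 < srate S i j" by (rule srate_basic_pos[OF crit]) (simp add: leaf)
  have \<beta>: "0 < pool S j" using crit j by (simp add: critically_loaded_def valid_system_def)
  have Lj: "L k j = 0" if "k \<noteq> i" for k
    using leaf[of k] basic[of k j] feas that j unfolding spp_feasible_def by (metis less_eq_real_def)
  have "(\<Sum>k<ncust S. L k j / (pool S j * srate S k j)) = L i j / (pool S j * srate S i j)"
    using i Lj by (subst sum.remove[of _ i]) auto
  then have Lij: "L i j = pool S j * srate S i j"
    using full_load[OF crit j card] \<mu> \<beta> by (simp add: L_def field_simps)
  define L' where "L' k s = (if s = j then 0 else L k s)" for k s
  have row: "(\<Sum>s\<in>servers S - {j}. f s) = (\<Sum>s\<in>servers S. f s) - f j" for f :: "'a \<Rightarrow> real"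
    using j finite_J by (simp add: sum.remove)
  have feas': "spp_feasible ?S L' 1"
    unfolding spp_feasible_def remove_leaf_simps
  proof (intro conjI allI ballI impI)
    show "0 \<le> L' k s" for k s using feas by (simp add: L'_def spp_feasible_def)
    show "L' k s = 0" if "\<not> (k < ncust S \<and> s \<in> servers S - {j} \<and> srate S k s \<noteq> 0)" for k s
      using feas that by (auto simp: L'_def spp_feasible_def)
    show "(\<Sum>s\<in>servers S - {j}. L' k s) =
        ((arrival S)(i := arrival S i - pool S j * srate S i j)) k" if "k < ncust S" for k
    proof -
      have "(\<Sum>s\<in>servers S - {j}. L' k s) = (\<Sum>s\<in>servers S - {j}. L k s)"
        by (intro sum.cong) (auto simp: L'_def)
      also have "\<dots> = arrival S k - L k j" using feas that by (simp add: row spp_feasible_def)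
      finally show ?thesis using Lij Lj[of k] by auto
    qed
    show "(\<Sum>k<ncust S. L' k s / (pool S s * srate S k s)) \<le> 1" if "s \<in> servers S - {j}" for s
      using feas that by (simp add: L'_def spp_feasible_def)
  qed
  have uniq: "l' = L' \<and> r = 1" if f: "spp_feasible ?S l' r" and r: "r \<le> 1" for l' r
  proof -
    define l2 where "l2 k s = (if s = j then if k = i then pool S j * srate S i j else 0 else l' k s)" for k s
    have "spp_feasible S l2 1"
      unfolding spp_feasible_def
    proof (intro conjI allI ballI impI)
      show "0 \<le> l2 k s" for k s using f \<mu> \<beta> by (simp add: l2_def spp_feasible_def)
      show "l2 k s = 0" if "\<not> (k < ncust S \<and> s \<in> servers S \<and> srate S k s \<noteq> 0)" for k s
        using f that i j \<mu> by (auto simp: l2_def spp_feasible_def)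
      show "(\<Sum>s\<in>servers S. l2 k s) = arrival S k" if "k < ncust S" for k
      proof -
        have "(\<Sum>s\<in>servers S - {j}. l2 k s) = (\<Sum>s\<in>servers S - {j}. l' k s)"
          by (intro sum.cong) (auto simp: l2_def)
        also have "\<dots> = arrival ?S k" using f that by (simp add: spp_feasible_def)
        finally have "(\<Sum>s\<in>servers S. l2 k s) = arrival ?S k + l2 k j"
          using row[of "l2 k"] by simp
        then show ?thesis by (simp add: l2_def[of k j])
      qed
      show "(\<Sum>k<ncust S. l2 k s / (pool S s * srate S k s)) \<le> 1" if "s \<in> servers S" for s
      proof (cases "s = j")
        case True
        have "(\<Sum>k<ncust S. l2 k j / (pool S j * srate S k j)) = l2 i j / (pool S j * srate S i j)"
          using i by (subst sum.remove[of _ i]) (auto simp: l2_def)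
        also have "\<dots> = 1" using \<mu> \<beta> by (simp add: l2_def)
        finally show ?thesis using True by simp
      next
        case False
        then have "(\<Sum>k<ncust S. l' k s / (pool S s * srate S k s)) \<le> r"
          using f that by (simp add: spp_feasible_def)
        then show ?thesis using False r by (simp add: l2_def)
      qed
    qed
    then have l2: "l2 = L" unfolding L_def by (rule critically_loadedD[OF crit])
    have eq: "l' k s = L' k s" for k s
    proof (cases "s = j")
      case True
      then show ?thesis using f by (simp add: L'_def spp_feasible_def)
    next
      case False
      then show ?thesis using fun_cong[OF fun_cong[OF l2], of k s] by (simp add: L'_def l2_def)
    qed
    \<comment> \<open>Any remaining server, such as \<open>l\<close>, is fully loaded under
      \<open>L'\<close>, so no value below 1 is feasible.\<close>
    have "(\<Sum>k<ncust S. l' k l / (pool S l * srate S k l)) \<le> r"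
      using f m by (simp add: spp_feasible_def)
    then have "1 \<le> r" using full_load[OF crit m(1) card] m(2) by (simp add: eq L'_def L_def)
    then show ?thesis using eq r by auto
  qed
  have sol: "spp_solution ?S = (L', 1)" and ex1: "\<exists>!p. spp_optimal ?S p"
    by (rule spp_solution_eqI[OF feas'], (erule uniq, assumption))+
  show basic': "basic_activities ?S = basic_activities S - {(i, j)}"
    using leaf by (auto simp: basic basic_activities_def sol L'_def L_def[symmetric])
  \<comment> \<open>The reduced arrival rate stays positive because \<open>i\<close> has positive
    flow to the further server \<open>m\<close>.\<close>
  have "0 < L i m" using m(3) basic by simp
  also have "\<dots> \<le> (\<Sum>s\<in>servers S - {j}. L i s)"
    using m basic feas finite_J by (intro member_le_sum) (auto simp: spp_feasible_def)
  also have "\<dots> = arrival S i - pool S j * srate S i j"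
    using feas i Lij by (simp add: row spp_feasible_def)
  finally have "valid_system ?S"
    using crit m by (auto simp: critically_loaded_def valid_system_def)
  moreover have "undirected_tree (Inl ` {..<ncust S} \<union> Inr ` (servers S - {j}))
      (adjacency (basic_activities S - {(i, j)}))"
    using i by (intro undirected_tree_remove_leaf[OF tree leaf]) auto
  ultimately show "critically_loaded ?S"
    unfolding critically_loaded_def complete_resource_pooling_def
    using ex1 sol basic' by simp
qed

lemma mode_remove_leaf_iff:
  assumes crit: "critically_loaded S" and j: "j \<in> servers S"
    and leaf: "\<And>k. (k, j) \<in> basic_activities S \<longleftrightarrow> k = i"
    and basic': "basic_activities (remove_leaf S i j) = basic_activities S - {(i, j)}"
  shows "mode (remove_leaf S i j) e z \<longleftrightarrow> mode S e z"
proof -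
  have fin: "finite (servers S)" using crit by (simp add: critically_loaded_def valid_system_def)
  have i: "i < ncust S" using leaf[of i] by (simp add: basic_activities_def)
  have iff: ?thesis if z: "\<And>k. z k j = 0"
  proof -
    have "(\<Sum>s\<in>servers S - {j}. c s * z k s) = (\<Sum>s\<in>servers S. c s * z k s)" for c k
      using fin z by (intro sum.mono_neutral_left) auto
    moreover have "(\<forall>k s. (k, s) \<notin> basic_activities S - {(i, j)} \<longrightarrow> z k s = 0) \<longleftrightarrow>
       (\<forall>k s. (k, s) \<notin> basic_activities S \<longrightarrow> z k s = 0)"
      using z by auto
    moreover have "(\<forall>s\<in>servers S - {j}. (\<Sum>i<ncust S. z i s) = 0) \<longleftrightarrow>
       (\<forall>s\<in>servers S. (\<Sum>i<ncust S. z i s) = 0)"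
      using z by auto
    ultimately show ?thesis unfolding mode_def basic' remove_leaf_simps by presburger
  qed
  show ?thesis
  proof
    assume m: "mode (remove_leaf S i j) e z"
    then have "z k j = 0" for k using leaf by (auto simp: mode_def basic')
    then show "mode S e z" using iff m by blast
  next
    assume m: "mode S e z"
    then have off: "z k j = 0" if "k \<noteq> i" for k using leaf that by (auto simp: mode_def)
    have "(\<Sum>k<ncust S. z k j) = z i j" using i off by (subst sum.remove[of _ i]) auto
    then have "z i j = 0" using m j by (simp add: mode_def)
    then have "z k j = 0" for k using off by (cases "k = i") auto
    then show "mode (remove_leaf S i j) e z" using iff m by blast
  qed
qed

subsection \<open>Splitting a server\<close>

text \<open>Adding the flows through \<open>j'\<close> and \<open>j''\<close> keeps all weighted row
  sums, as the rates are inherited. Conversely, every customer of \<open>j\<close> except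
  \<open>i\<close> is assigned to one half; only the flow of \<open>i\<close> must be divided, and
  the balance at \<open>j'\<close> dictates how.\<close>

lemma expansion_locally_stable_iff:
  fixes S S' :: "'j system"
  assumes exp: "expansion S S'"
  shows "locally_stable S \<longleftrightarrow> locally_stable S'"
proof -
  obtain i j j' j'' K where crit: "critically_loaded S" "critically_loaded S'"
    and ij: "(i, j) \<in> basic_activities S"
    and j: "j' \<noteq> j''" "j' \<notin> servers S - {j}" "j'' \<notin> servers S - {j}"
    and K: "K \<subseteq> custs_of S j - {i}"
    and n': "ncust S' = ncust S"
    and J': "servers S' = (servers S - {j}) \<union> {j', j''}"
    and E': "basic_activities S' = {(k, m) \<in> basic_activities S. m \<noteq> j} \<union>
          (insert i K) \<times> {j'} \<union> (custs_of S j - K) \<times> {j''}"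
    and r0: "\<forall>(k, m) \<in> basic_activities S. m \<noteq> j \<longrightarrow> srate S' k m = srate S k m"
    and r1: "\<forall>k \<in> insert i K. srate S' k j' = srate S k j"
    and r2: "\<forall>k \<in> custs_of S j - K. srate S' k j'' = srate S k j"
    using exp unfolding expansion_def by (elim exE conjE) (rule that)
  define n where "n = ncust S"
  define J where "J = servers S - {j}"
  define E where "E = basic_activities S"
  have fin: "finite (servers S)" using crit(1) by (simp add: critically_loaded_def valid_system_def)
  have jS: "j \<in> servers S" "i < n" using ij by (auto simp: basic_activities_def n_def)
  have E_sub: "k < n \<and> m \<in> servers S" if "(k, m) \<in> E" for k m
    using that by (auto simp: E_def basic_activities_def n_def)
  have KE: "(k, j) \<in> E" if "k \<in> K" for k
    using K that by (auto simp: custs_of_def E_def)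
  have notK: "i \<notin> K" using K by auto
  have E'_iff: "(k, m) \<in> basic_activities S' \<longleftrightarrow>
      (k, m) \<in> E \<and> m \<in> J \<or> m = j' \<and> (k = i \<or> k \<in> K) \<or> m = j'' \<and> (k, j) \<in> E \<and> k \<notin> K" for k m
    unfolding E' using E_sub[of k m] by (auto simp: J_def E_def custs_of_def)
  \<comment> \<open>One of \<open>j'\<close>, \<open>j''\<close> may reuse the name
    \<open>j\<close>; the set \<open>J\<close> avoids all three.\<close>
  have jJ: "j \<notin> J" "j' \<notin> J" "j'' \<notin> J" using j by (auto simp: J_def)
  have sumS: "(\<Sum>m\<in>servers S. f m) = (\<Sum>m\<in>J. f m) + f j" for f :: "'j \<Rightarrow> complex"
    using fin jS by (simp add: J_def sum.remove add.commute)
  have sumS': "(\<Sum>m\<in>servers S'. f m) = (\<Sum>m\<in>J. f m) + (f j' + f j'')" for f :: "'j \<Rightarrow> complex"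
  proof -
    have "servers S' = insert j' (insert j'' J)" using J' by (auto simp: J_def)
    moreover have "finite J" using fin by (simp add: J_def)
    ultimately show ?thesis using jJ j(1) by (simp add: add_ac)
  qed
  have mem: "m \<in> servers S \<longleftrightarrow> m \<in> J \<or> m = j" "m \<in> servers S' \<longleftrightarrow> m \<in> J \<or> m = j' \<or> m = j''" for m
    using jS J' by (auto simp: J_def)
  have rate0: "srate S' k m = srate S k m" if "(k, m) \<in> E" "m \<in> J" for k m
    using r0 that by (auto simp: E_def J_def)
  have rate1: "srate S' k j' = srate S k j" if "k = i \<or> k \<in> K" for k
    using r1 that by auto
  have rate2: "srate S' k j'' = srate S k j" if "(k, j) \<in> E" "k \<notin> K" for k
    using r2 that by (auto simp: E_def custs_of_def)
  have iE: "(i, j) \<in> E" using ij by (simp add: E_def)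
  have row_eq: "(\<Sum>m\<in>servers S'. (e + of_real (srate S' k m)) * z' k m) =
      (\<Sum>m\<in>servers S. (e + of_real (srate S k m)) * z k m)"
    if off: "\<And>k m. (k, m) \<notin> basic_activities S' \<Longrightarrow> z' k m = 0"
      and onJ: "\<And>k m. m \<in> J \<Longrightarrow> z k m = z' k m" and onj: "\<And>k. z k j = z' k j' + z' k j''"
    for e :: complex and z z' :: "nat \<Rightarrow> 'j \<Rightarrow> complex" and k
  proof -
    have on: "(e + of_real (srate S' k m)) * z' k m = (e + of_real (srate S k m)) * z k m" if m: "m \<in> J" for m
    proof (cases "(k, m) \<in> E")
      case True
      then show ?thesis using rate0 m onJ[OF m] by simp
    next
      case False
      then have "z' k m = 0" using off m jJ by (auto simp: E'_iff)
      then show ?thesis using onJ[OF m] by simp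
    qed
    have half1: "(e + of_real (srate S' k j')) * z' k j' = (e + of_real (srate S k j)) * z' k j'"
    proof (cases "k = i \<or> k \<in> K")
      case False
      then have "z' k j' = 0" using off jJ j by (auto simp: E'_iff)
      then show ?thesis by simp
    qed (simp add: rate1)
    have half2: "(e + of_real (srate S' k j'')) * z' k j'' = (e + of_real (srate S k j)) * z' k j''"
    proof (cases "(k, j) \<in> E \<and> k \<notin> K")
      case False
      then have "z' k j'' = 0" using off jJ j by (auto simp: E'_iff)
      then show ?thesis by simp
    qed (simp add: rate2)
    show ?thesis unfolding sumS sumS' onj distrib_left half1 half2 using on by simp
  qed
  show ?thesis
  proof
    assume stable: "locally_stable S"
    show "locally_stable S'"
      unfolding locally_stable_iff_mode[OF crit(2)]
    proof (intro allI impI, elim conjE)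
      fix e z' k m assume mode: "mode S' e z'" and re: "0 \<le> Re e"
      have supp: "z' k m = 0" if "(k, m) \<notin> basic_activities S'" for k m
        using mode that by (simp add: mode_def)
      have col: "(\<Sum>k<n. z' k m) = 0" if "m \<in> J \<or> m = j' \<or> m = j''" for m
        using mode that by (simp add: mode_def n' n_def mem)
      define z where "z k m = (if m = j then z' k j' + z' k j'' else if m \<in> J then z' k m else 0)" for k m
      have zJ: "z k m = z' k m" if "m \<in> J" for k m using that jJ by (auto simp: z_def)
      have zj: "z k j = z' k j' + z' k j''" for k by (simp add: z_def)
      have rows: "(\<Sum>m\<in>servers S'. (e + of_real (srate S' k m)) * z' k m) =
          (\<Sum>m\<in>servers S. (e + of_real (srate S k m)) * z k m)" for k
        by (rule row_eq[of z' z, OF supp zJ zj])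
      have "mode S e z"
        unfolding mode_def
      proof (intro conjI allI impI ballI)
        show "z k m = 0" if "(k, m) \<notin> basic_activities S" for k m
        proof (cases "m = j")
          case True
          then have "k \<noteq> i" "k \<notin> K" "(k, j) \<notin> E" using that iE KE by (auto simp: E_def)
          then show ?thesis using True supp jJ j(1) by (simp add: z_def E'_iff)
        next
          case False
          then show ?thesis using that supp[of k m] jJ by (auto simp: z_def E'_iff E_def)
        qed
        show "(\<Sum>k<ncust S. z k m) = 0" if "m \<in> servers S" for m
          using that col[of m] col[of j'] col[of j''] jJ
          by (auto simp: mem zJ zj sum.distrib n_def[symmetric])
        show "\<exists>t. \<forall>i<ncust S. (\<Sum>j\<in>servers S. (e + of_real (srate S i j)) * z i j) = t"
          using mode unfolding mode_def n' rows by blast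
      qed
      then have z0: "z k m = 0" for k m
        using stable re unfolding locally_stable_iff_mode[OF crit(1)] by blast
      \<comment> \<open>A customer other than \<open>i\<close> uses at most one half, so nothing can
        cancel in the merged flow. The flow of \<open>i\<close> then vanishes by the balance at each
        half.\<close>
      have other: "z' k j' = 0 \<and> z' k j'' = 0" if "k \<noteq> i" for k
        using zj[of k] z0[of k j] supp[of k j'] supp[of k j''] that jJ j(1)
        by (cases "k \<in> K") (auto simp: E'_iff)
      have "(\<Sum>k<n. z' k l) = z' i l" if "l = j' \<or> l = j''" for l
        using jS other that by (subst sum.remove[of _ i]) auto
      then have "z' i j' = 0" "z' i j'' = 0" using col by auto
      then show "z' k m = 0"
        using other[of k] z0[of k m] zJ[of m k] supp[of k m]
        by (cases "k = i") (auto simp: E'_iff)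
    qed
  next
    assume stable: "locally_stable S'"
    show "locally_stable S"
      unfolding locally_stable_iff_mode[OF crit(1)]
    proof (intro allI impI, elim conjE)
      fix e z k m assume mode: "mode S e z" and re: "0 \<le> Re e"
      have supp: "z k m = 0" if "(k, m) \<notin> E" for k m
        using mode that by (simp add: mode_def E_def)
      have col: "(\<Sum>k<n. z k m) = 0" if "m \<in> J \<or> m = j" for m
        using mode that by (simp add: mode_def n_def mem)
      \<comment> \<open>The flow into \<open>j'\<close>: customers in \<open>K\<close> bring theirs
        along, and \<open>i\<close> contributes the negative of their total. The balance at
        \<open>j''\<close> is then inherited from \<open>j\<close>.\<close>
      define p where "p k = (if k \<in> K then z k j else 0) - (if k = i then \<Sum>l\<in>K. z l j else 0)" for k
      have "K \<subseteq> {..<n}" using KE E_sub by blast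
      then have "(\<Sum>k<n. if k \<in> K then z k j else 0) = (\<Sum>l\<in>K. z l j)"
        by (simp add: sum.If_cases Int_absorb1)
      then have p0: "(\<Sum>k<n. p k) = 0" using jS by (simp add: p_def sum_subtractf)
      define z' where "z' k m = (if m = j' then p k else if m = j'' then z k j - p k
        else if m \<in> J then z k m else 0)" for k m
      have zJ: "z k m = z' k m" if "m \<in> J" for k m using that jJ by (auto simp: z'_def)
      have z'j: "z' k j' = p k" "z' k j'' = z k j - p k" for k using j(1) by (auto simp: z'_def)
      have zj: "z k j = z' k j' + z' k j''" for k by (simp add: z'j)
      have supp': "z' k m = 0" if "(k, m) \<notin> basic_activities S'" for k m
        using that supp[of k m] supp[of k j] KE iE notK
        by (auto simp: z'_def E'_iff p_def)
      have rows: "(\<Sum>m\<in>servers S'. (e + of_real (srate S' k m)) * z' k m) =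
          (\<Sum>m\<in>servers S. (e + of_real (srate S k m)) * z k m)" for k
        by (rule row_eq[of z' z, OF supp' zJ zj])
      have "mode S' e z'"
        unfolding mode_def
      proof (intro conjI allI impI ballI)
        show "z' k m = 0" if "(k, m) \<notin> basic_activities S'" for k m by (rule supp'[OF that])
        show "(\<Sum>k<ncust S'. z' k m) = 0" if "m \<in> servers S'" for m
          using that col[of m] col[of j] p0
          by (auto simp: mem zJ[symmetric] z'j sum_subtractf n_def[symmetric] n')
        show "\<exists>t. \<forall>i<ncust S'. (\<Sum>j\<in>servers S'. (e + of_real (srate S' i j)) * z' i j) = t"
          using mode unfolding mode_def n' rows by blast
      qed
      then have z0: "z' k m = 0" for k m
        using stable re unfolding locally_stable_iff_mode[OF crit(2)] by blast
      then show "z k m = 0" using zj[of k] zJ[of m k] supp[of k m] E_sub[of k m] mem(1)[of m] by auto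
    qed
  qed
qed

subsection \<open>A cubic polynomial and graphs on four vertices\<close>

text \<open>For a non-real root the imaginary part of the equation, divided by \<open>b\<close>,
  determines \<open>b\<^sup>2\<close>. Inserted into the real part, it leaves a cubic in
  \<open>a\<close> with positive coefficients, whose constant term is the Hurwitz
  difference.\<close>

lemma cubic_no_root_Re_nonneg:
  fixes x :: complex and c\<^sub>0 c\<^sub>1 c\<^sub>2 c\<^sub>3 :: real
  assumes pos: "0 < c\<^sub>0" "0 < c\<^sub>1" "0 < c\<^sub>2" "0 < c\<^sub>3" and hurwitz: "c\<^sub>3 * c\<^sub>0 < c\<^sub>2 * c\<^sub>1"
    and re: "0 \<le> Re x"
  shows "of_real c\<^sub>3 * x ^ 3 + of_real c\<^sub>2 * x\<^sup>2 + of_real c\<^sub>1 * x + of_real c\<^sub>0 \<noteq> 0"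
proof
  assume root: "of_real c\<^sub>3 * x ^ 3 + of_real c\<^sub>2 * x\<^sup>2 + of_real c\<^sub>1 * x + of_real c\<^sub>0 = 0"
  define a b where "a = Re x" and "b = Im x"
  have a: "0 \<le> a" using re by (simp add: a_def)
  have R: "c\<^sub>3 * (a ^ 3 - 3 * a * b\<^sup>2) + c\<^sub>2 * (a\<^sup>2 - b\<^sup>2) + c\<^sub>1 * a + c\<^sub>0 = 0"
    using arg_cong[OF root, of Re] by (simp add: a_def b_def power2_eq_square power3_eq_cube algebra_simps)
  have I: "b * (c\<^sub>3 * (3 * a\<^sup>2 - b\<^sup>2) + 2 * c\<^sub>2 * a + c\<^sub>1) = 0"
    using arg_cong[OF root, of Im] by (simp add: a_def b_def power2_eq_square power3_eq_cube algebra_simps)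
  show False
  proof (cases "b = 0")
    case True
    then have "c\<^sub>3 * a ^ 3 + c\<^sub>2 * a\<^sup>2 + c\<^sub>1 * a + c\<^sub>0 = 0" using R by simp
    moreover have "0 \<le> c\<^sub>3 * a ^ 3" "0 \<le> c\<^sub>2 * a\<^sup>2" "0 \<le> c\<^sub>1 * a" using a pos by simp_all
    ultimately show False using pos by linarith
  next
    case False
    define s where "s = 3 * c\<^sub>3 * a\<^sup>2 + 2 * c\<^sub>2 * a + c\<^sub>1"
    have "c\<^sub>3 * (3 * a\<^sup>2 - b\<^sup>2) + 2 * c\<^sub>2 * a + c\<^sub>1 = 0" using I False by simp
    then have s: "c\<^sub>3 * b\<^sup>2 = s" by (simp add: s_def algebra_simps)
    have "c\<^sub>3 * a ^ 3 + c\<^sub>2 * a\<^sup>2 + c\<^sub>1 * a + c\<^sub>0 = b\<^sup>2 * (3 * c\<^sub>3 * a + c\<^sub>2)"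
      using R by (simp add: algebra_simps)
    then have "c\<^sub>3 * (c\<^sub>3 * a ^ 3 + c\<^sub>2 * a\<^sup>2 + c\<^sub>1 * a + c\<^sub>0) = s * (3 * c\<^sub>3 * a + c\<^sub>2)" using s by simp
    then have "8 * (c\<^sub>3\<^sup>2 * a ^ 3) + 8 * (c\<^sub>3 * c\<^sub>2 * a\<^sup>2) + 2 * (c\<^sub>2\<^sup>2 * a) + 2 * (c\<^sub>3 * c\<^sub>1 * a) + (c\<^sub>2 * c\<^sub>1 - c\<^sub>3 * c\<^sub>0) = 0"
      by (simp add: s_def algebra_simps power2_eq_square power3_eq_cube)
    moreover have "0 \<le> c\<^sub>3\<^sup>2 * a ^ 3" "0 \<le> c\<^sub>3 * c\<^sub>2 * a\<^sup>2" "0 \<le> c\<^sub>2\<^sup>2 * a" "0 \<le> c\<^sub>3 * c\<^sub>1 * a"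
      using a pos by simp_all
    ultimately show False using hurwitz by linarith
  qed
qed

lemma path_determinant_nonzero:
  fixes x :: complex and p q r p' q' r' :: real
  assumes pos: "0 < p" "0 < q" "0 < r" "0 < p'" "0 < q'" "0 < r'" and re: "0 \<le> Re x"
  shows "(2 * x + of_real p) * (x + of_real q) * (x + of_real r) +
    (2 * x + of_real p') * (x + of_real q') * (x + of_real r') \<noteq> 0"
proof -
  define c0 c1 c2 where "c0 = p * q * r + p' * q' * r'"
    and "c1 = p * (q + r) + 2 * q * r + (p' * (q' + r') + 2 * q' * r')"
    and "c2 = p + p' + 2 * (q + r) + 2 * (q' + r')"
  have c: "0 < c0" "0 < c1" "0 < c2" using pos by (simp_all add: c0_def c1_def c2_def add_pos_pos)
  \<comment> \<open>The cubic has leading coefficient 2 + 2 = 4. The mixed products are positive by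
    themselves; the product belonging to each summand absorbs its term \<open>4 * p * q * r\<close>
    (respectively the primed one) and still has only positive monomials left.\<close>
  have "c2 * c1 - 4 * c0 =
      (p + 2 * q + 2 * r) * (p' * (q' + r') + 2 * q' * r') +
      (p * p * (q + r) + 2 * p * (q * q + r * r) + 2 * p * q * r + 4 * (q + r) * q * r) +
      (p' + 2 * q' + 2 * r') * (p * (q + r) + 2 * q * r) +
      (p' * p' * (q' + r') + 2 * p' * (q' * q' + r' * r') + 2 * p' * q' * r' + 4 * (q' + r') * q' * r')"
    unfolding c0_def c1_def c2_def by (simp add: algebra_simps)
  also have "\<dots> > 0" by (intro add_pos_pos mult_pos_pos pos zero_less_numeral)
  finally have "4 * c0 < c2 * c1" by simp
  from cubic_no_root_Re_nonneg[OF c _ this re]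
  show ?thesis by (simp add: c0_def c1_def c2_def power2_eq_square power3_eq_cube algebra_simps)
qed

text \<open>Numerator and denominator have the same imaginary part, so multiplying by the conjugate
  denominator gives the real part \<open>(Re x + a) * (Re x + b) + (Im x)\<^sup>2\<close>.\<close>

lemma Re_quotient_nonneg:
  fixes x :: complex and a b :: real
  assumes "0 \<le> Re x" "0 < a" "0 < b"
  shows "0 \<le> Re ((x + of_real a) / (x + of_real b))"
  using assms by (simp add: Re_divide)

text \<open>Without a dominating vertex only the path and the 4-cycle on four vertices remain. Both
  satisfy the second alternative, which leaves \<open>R a d\<close> open; for customers of a tree
  \<open>path_ends_not_share\<close> rules out the 4-cycle.\<close>

lemma connected_graph_le_4:
  fixes R :: "nat \<Rightarrow> nat \<Rightarrow> bool"
  assumes n: "0 < n" "n \<le> 4" and sym: "\<And>a b. R a b \<Longrightarrow> R b a"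
    and cut: "\<And>A i k. A \<subseteq> {..<n} \<Longrightarrow> i \<in> A \<Longrightarrow> k < n \<Longrightarrow> k \<notin> A \<Longrightarrow> \<exists>a\<in>A. \<exists>b<n. b \<notin> A \<and> R a b"
  shows "(\<exists>r<n. \<forall>k<n. k \<noteq> r \<longrightarrow> R k r) \<or>
    (\<exists>a b c d. distinct [a, b, c, d] \<and> {..<n} = {a, b, c, d} \<and> R a b \<and> R b c \<and> R c d \<and>
       \<not> R a c \<and> \<not> R b d)"
proof -
  consider "n = 1" | "n = 2" | "n = 3" | "n = 4" using n by linarith
  then show ?thesis
  proof cases
    case 1
    then show ?thesis by auto
  next
    case 2
    have "R 0 1" using cut[of "{0}" 0 1] by (auto simp: 2 less_Suc_eq numeral_2_eq_2)
    then show ?thesis using 2 sym by (intro disjI1 exI[of _ 0]) (auto simp: numeral_2_eq_2 less_Suc_eq)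
  next
    case 3
    have c: "R 0 1 \<or> R 0 2" "R 0 1 \<or> R 1 2" "R 0 2 \<or> R 1 2"
      using cut[of "{0}" 0 1] cut[of "{1}" 1 0] cut[of "{2}" 2 0] sym
      by (auto simp: 3 less_Suc_eq numeral_3_eq_3 numeral_2_eq_2)
    have "{..<n} = {0, 1, 2}" using 3 by auto
    then have all: "(\<forall>k<n. P k) \<longleftrightarrow> P 0 \<and> P 1 \<and> P 2" "(\<exists>k<n. P k) \<longleftrightarrow> P 0 \<or> P 1 \<or> P 2" for P
      by (auto simp: set_eq_iff)
    have symeq: "R 1 0 = R 0 1" "R 2 0 = R 0 2" "R 2 1 = R 1 2" using sym by blast+
    have "\<exists>r<n. \<forall>k<n. k \<noteq> r \<longrightarrow> R k r" using c symeq unfolding all by simp argo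
    then show ?thesis ..
  next
    case 4
    have n4: "{..<n} = {0, 1, 2, 3}" using 4 by auto
    have all: "(\<forall>k<n. P k) \<longleftrightarrow> P 0 \<and> P 1 \<and> P 2 \<and> P 3" "(\<exists>k<n. P k) \<longleftrightarrow> P 0 \<or> P 1 \<or> P 2 \<or> P 3" for P
      using n4 by (auto simp: set_eq_iff)
    have symeq: "R 1 0 = R 0 1" "R 2 0 = R 0 2" "R 3 0 = R 0 3" "R 2 1 = R 1 2" "R 3 1 = R 1 3" "R 3 2 = R 2 3"
      using sym by blast+
    \<comment> \<open>Connectedness, written out for the seven cuts of a four-element set.\<close>
    have c: "R 0 1 \<or> R 0 2 \<or> R 0 3" "R 0 1 \<or> R 1 2 \<or> R 1 3" "R 0 2 \<or> R 1 2 \<or> R 2 3"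
       "R 0 3 \<or> R 1 3 \<or> R 2 3" "R 0 2 \<or> R 0 3 \<or> R 1 2 \<or> R 1 3" "R 0 1 \<or> R 0 3 \<or> R 1 2 \<or> R 2 3"
       "R 0 1 \<or> R 0 2 \<or> R 1 3 \<or> R 2 3"
      using cut[of "{0}" 0 1] cut[of "{1}" 1 0] cut[of "{2}" 2 0] cut[of "{3}" 3 0]
        cut[of "{0, 1}" 0 2] cut[of "{0, 2}" 0 1] cut[of "{0, 3}" 0 1] n4
      unfolding all by (simp_all add: symeq[unfolded One_nat_def] 4)
    show ?thesis
    proof (rule ccontr)
      assume neg: "\<not> ?thesis"
      then have dom: "\<not> (R 0 1 \<and> R 0 2 \<and> R 0 3)" "\<not> (R 0 1 \<and> R 1 2 \<and> R 1 3)"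
        "\<not> (R 0 2 \<and> R 1 2 \<and> R 2 3)" "\<not> (R 0 3 \<and> R 1 3 \<and> R 2 3)"
        unfolding all by (simp_all add: symeq[unfolded One_nat_def])
      have path: "\<not> (R a b \<and> R b c \<and> R c d \<and> \<not> R a c \<and> \<not> R b d)"
        if "distinct [a, b, c, d]" "{a, b, c, d} = {0, 1, 2, 3}" for a b c d
      proof
        assume "R a b \<and> R b c \<and> R c d \<and> \<not> R a c \<and> \<not> R b d"
        moreover have "{..<n} = {a, b, c, d}" using that(2) n4 by simp
        ultimately show False using neg that(1) by blast
      qed
      \<comment> \<open>The twelve orderings of the four vertices up to reversal.\<close>
      have "\<not> (R 0 1 \<and> R 1 2 \<and> R 2 3 \<and> \<not> R 0 2 \<and> \<not> R 1 3)"
        "\<not> (R 0 1 \<and> R 1 3 \<and> R 3 2 \<and> \<not> R 0 3 \<and> \<not> R 1 2)"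
        "\<not> (R 0 2 \<and> R 2 1 \<and> R 1 3 \<and> \<not> R 0 1 \<and> \<not> R 2 3)"
        "\<not> (R 0 2 \<and> R 2 3 \<and> R 3 1 \<and> \<not> R 0 3 \<and> \<not> R 2 1)"
        "\<not> (R 0 3 \<and> R 3 1 \<and> R 1 2 \<and> \<not> R 0 1 \<and> \<not> R 3 2)"
        "\<not> (R 0 3 \<and> R 3 2 \<and> R 2 1 \<and> \<not> R 0 2 \<and> \<not> R 3 1)"
        "\<not> (R 1 0 \<and> R 0 2 \<and> R 2 3 \<and> \<not> R 1 2 \<and> \<not> R 0 3)"
        "\<not> (R 1 0 \<and> R 0 3 \<and> R 3 2 \<and> \<not> R 1 3 \<and> \<not> R 0 2)"
        "\<not> (R 1 2 \<and> R 2 0 \<and> R 0 3 \<and> \<not> R 1 0 \<and> \<not> R 2 3)"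
        "\<not> (R 1 3 \<and> R 3 0 \<and> R 0 2 \<and> \<not> R 1 0 \<and> \<not> R 3 2)"
        "\<not> (R 2 0 \<and> R 0 1 \<and> R 1 3 \<and> \<not> R 2 1 \<and> \<not> R 0 3)"
        "\<not> (R 2 1 \<and> R 1 0 \<and> R 0 3 \<and> \<not> R 2 0 \<and> \<not> R 1 3)"
        by (rule path; auto)+
      with c dom symeq show False by argo
    qed
  qed
qed

subsection \<open>Systems with at most four customer types\<close>

context bipartite_tree
begin

lemma common_server_unique:
  assumes "(a, s) \<in> E" "(b, s) \<in> E" "(a, t) \<in> E" "(b, t) \<in> E" "a \<noteq> b"
  shows "s = t"
proof (rule ccontr)
  assume "s \<noteq> t"
  show False
    by (rule no_cycle[of "[Inl a, Inr s, Inl b, Inr t]"])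
      (use assms \<open>s \<noteq> t\<close> in \<open>auto simp: less_Suc_eq\<close>)
qed

text \<open>Otherwise the three servers are pairwise different by
  \<open>common_server_unique\<close> and close a cycle of length six.\<close>

lemma triangle_common_server:
  assumes "(a, s) \<in> E" "(b, s) \<in> E" "(b, t) \<in> E" "(c, t) \<in> E" "(c, u) \<in> E" "(a, u) \<in> E"
    and "distinct [a, b, c]"
  shows "s = t"
proof (rule ccontr)
  assume "s \<noteq> t"
  then have "u \<noteq> s" "u \<noteq> t"
    using assms common_server_unique[of b s c t] common_server_unique[of a s b t] by auto
  show False
    by (rule no_cycle[of "[Inl a, Inr s, Inl b, Inr t, Inl c, Inr u]"])
      (use assms \<open>s \<noteq> t\<close> \<open>u \<noteq> s\<close> \<open>u \<noteq> t\<close> in \<open>auto simp: less_Suc_eq\<close>)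
qed

definition share :: "nat \<Rightarrow> nat \<Rightarrow> bool" where
  "share a b \<longleftrightarrow> a \<noteq> b \<and> (\<exists>j. (a, j) \<in> E \<and> (b, j) \<in> E)"

lemma shareI: "(a, j) \<in> E \<Longrightarrow> (b, j) \<in> E \<Longrightarrow> a \<noteq> b \<Longrightarrow> share a b"
  by (auto simp: share_def)

lemma share_sym: "share a b \<Longrightarrow> share b a"
  by (auto simp: share_def)

text \<open>The four servers would close a cycle of length eight; they are distinct because any
  coincidence makes \<open>a\<close>, \<open>c\<close> or \<open>b\<close>, \<open>d\<close> share a
  server.\<close>

lemma path_ends_not_share:
  assumes "share a b" "share b c" "share c d" "\<not> share a c" "\<not> share b d" "distinct [a, b, c, d]"
  shows "\<not> share a d"
proof
  assume "share a d"
  then obtain s t u v where e: "(a, s) \<in> E" "(b, s) \<in> E" "(b, t) \<in> E" "(c, t) \<in> E"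
    "(c, u) \<in> E" "(d, u) \<in> E" "(d, v) \<in> E" "(a, v) \<in> E"
    using assms by (auto simp: share_def)
  then have "distinct [s, t, u, v]"
    using assms(4-6) by (auto simp: share_def)
  then show False
    by (intro no_cycle[of "[Inl a, Inr s, Inl b, Inr t, Inl c, Inr u, Inl d, Inr v]"])
      (use e assms(6) in \<open>auto simp: less_Suc_eq\<close>)
qed

lemma single_customer_eq_0:
  fixes z :: "nat \<Rightarrow> 'j \<Rightarrow> 'a::comm_monoid_add"
  assumes supp: "\<And>i j. (i, j) \<notin> E \<Longrightarrow> z i j = 0" and col: "\<And>j. j \<in> J \<Longrightarrow> (\<Sum>i<n. z i j) = 0"
    and only: "\<And>m. (m, j) \<in> E \<Longrightarrow> m = i"
  shows "z i j = 0"
proof (rule ccontr)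
  assume "z i j \<noteq> 0"
  then have "i < n" "j \<in> J" using supp E_subset by auto
  then obtain m where "m \<noteq> i" "z m j \<noteq> 0"
    using ex_other_nonzero_summand[OF _ col, of j i] \<open>z i j \<noteq> 0\<close> by auto
  then show False using only supp by blast
qed

end

section \<open>Elimination in the row equations of a mode\<close>

lemma sum_eq_2:
  fixes f :: "'a \<Rightarrow> 'b::comm_monoid_add"
  assumes "finite A" "a \<in> A" "b \<in> A" "a \<noteq> b" "\<And>x. x \<in> A \<Longrightarrow> x \<noteq> a \<Longrightarrow> x \<noteq> b \<Longrightarrow> f x = 0"
  shows "sum f A = f a + f b"
proof -
  have "sum f A = sum f {a, b}" using assms by (intro sum.mono_neutral_right) auto
  then show ?thesis using assms by simp
qed

lemma sum_eq_1:
  fixes f :: "'a \<Rightarrow> 'b::comm_monoid_add"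
  assumes "finite A" "a \<in> A" "\<And>x. x \<in> A \<Longrightarrow> x \<noteq> a \<Longrightarrow> f x = 0"
  shows "sum f A = f a"
proof -
  have "sum f A = sum f {a}" using assms by (intro sum.mono_neutral_right) auto
  then show ?thesis by simp
qed

text \<open>A customer \<open>r\<close> who shares a server with everyone else: eliminating the other customers leaves
  \<open>t (1 + \<Sum>\<^sub>k (e + \<mu>\<^sub>r) / (e + \<mu>\<^sub>k)) = 0\<close>, where the quotients have non-negative real part.\<close>

lemma (in bipartite_tree) dominated_mode_eq_0:
  fixes z :: "nat \<Rightarrow> 'j \<Rightarrow> complex" and \<mu> :: "nat \<Rightarrow> 'j \<Rightarrow> real"
  assumes supp: "\<And>i j. (i, j) \<notin> E \<Longrightarrow> z i j = 0" and col: "\<And>j. j \<in> J \<Longrightarrow> (\<Sum>i<n. z i j) = 0"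
    and row: "\<And>i. i < n \<Longrightarrow> (\<Sum>j\<in>J. (e + of_real (\<mu> i j)) * z i j) = t"
    and pos: "\<And>i j. (i, j) \<in> E \<Longrightarrow> 0 < \<mu> i j" and re: "0 \<le> Re e"
    and r: "r < n" and dom: "\<And>k. k < n \<Longrightarrow> k \<noteq> r \<Longrightarrow> share k r"
  shows "z i j = 0"
proof -
  define \<alpha> where "\<alpha> i j = e + of_real (\<mu> i j)" for i j
  have \<alpha>: "\<alpha> i j \<noteq> 0" if "(i, j) \<in> E" for i j
    using pos[OF that] re by (auto simp: \<alpha>_def complex_eq_iff)
  have "\<exists>s. \<forall>k. k < n \<and> k \<noteq> r \<longrightarrow> (k, s k) \<in> E \<and> (r, s k) \<in> E"
    using dom unfolding share_def by metis
  then obtain s where s: "\<And>k. k < n \<Longrightarrow> k \<noteq> r \<Longrightarrow> (k, s k) \<in> E"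
    "\<And>k. k < n \<Longrightarrow> k \<noteq> r \<Longrightarrow> (r, s k) \<in> E" by blast
  \<comment> \<open>Any other server of \<open>k\<close> has \<open>k\<close> as its only customer:
    \<open>r\<close> there would be a second common server, and a third customer would form a
    triangle with \<open>k\<close> and \<open>r\<close>.\<close>
  have off: "z k j = 0" if k: "k < n" "k \<noteq> r" and "j \<noteq> s k" for k j
  proof (cases "(k, j) \<in> E")
    case True
    show ?thesis
    proof (rule single_customer_eq_0[of z, OF supp col])
      fix m assume m: "(m, j) \<in> E"
      then have mn: "m < n" using E_subset by auto
      show "m = k"
      proof (rule ccontr)
        assume "m \<noteq> k"
        show False
        proof (cases "m = r")
          case True
          with m \<open>(k, j) \<in> E\<close> s[OF k] k that(3) show False
            using common_server_unique[of k j r "s k"] by auto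
        next
          case False
          then show False
            using triangle_common_server[of r "s k" k j m "s m"] s[OF k] s[OF mn] \<open>(k, j) \<in> E\<close> m
              \<open>m \<noteq> k\<close> k that(3) by auto
        qed
      qed
    qed
  qed (rule supp)
  have val: "z k (s k) = t / \<alpha> k (s k)" if k: "k < n" "k \<noteq> r" for k
  proof -
    have "s k \<in> J" using s[OF k] E_subset by auto
    then have "(\<Sum>j\<in>J. \<alpha> k j * z k j) = \<alpha> k (s k) * z k (s k)"
      using off[OF k] finite_J by (intro sum_eq_1) auto
    then show ?thesis using row[OF k(1)] \<alpha>[OF s(1)[OF k]] by (simp add: \<alpha>_def field_simps)
  qed
  have zr: "z r j = - (\<Sum>k\<in>{..<n} - {r}. z k j)" if "j \<in> J" for j
    using col[OF that] r by (simp add: sum.remove[of "{..<n}" r] eq_neg_iff_add_eq_0)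
  have re_pos: "0 < Re (1 + (\<Sum>k\<in>{..<n} - {r}. \<alpha> r (s k) / \<alpha> k (s k)))"
  proof -
    have "0 \<le> Re (\<alpha> r (s k) / \<alpha> k (s k))" if "k \<in> {..<n} - {r}" for k
      using that s pos re unfolding \<alpha>_def by (intro Re_quotient_nonneg) auto
    then have "0 \<le> (\<Sum>k\<in>{..<n} - {r}. Re (\<alpha> r (s k) / \<alpha> k (s k)))" by (rule sum_nonneg)
    then show ?thesis by simp
  qed
  have "t = (\<Sum>j\<in>J. \<alpha> r j * z r j)" using row[OF r] by (simp add: \<alpha>_def)
  also have "\<dots> = - (\<Sum>j\<in>J. \<Sum>k\<in>{..<n} - {r}. \<alpha> r j * z k j)"
    by (simp add: zr sum_distrib_left sum_negf cong: sum.cong_simp)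
  also have "\<dots> = - (\<Sum>k\<in>{..<n} - {r}. \<Sum>j\<in>J. \<alpha> r j * z k j)"
    by (subst sum.swap) (rule refl)
  also have "(\<Sum>k\<in>{..<n} - {r}. \<Sum>j\<in>J. \<alpha> r j * z k j) = (\<Sum>k\<in>{..<n} - {r}. \<alpha> r (s k) / \<alpha> k (s k) * t)"
  proof (intro sum.cong refl)
    fix k assume "k \<in> {..<n} - {r}"
    then have k: "k < n" "k \<noteq> r" by auto
    have "s k \<in> J" using s[OF k] E_subset by auto
    then have "(\<Sum>j\<in>J. \<alpha> r j * z k j) = \<alpha> r (s k) * z k (s k)"
      using off[OF k] finite_J by (intro sum_eq_1) auto
    then show "(\<Sum>j\<in>J. \<alpha> r j * z k j) = \<alpha> r (s k) / \<alpha> k (s k) * t" by (simp add: val[OF k])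
  qed
  finally have "t * (1 + (\<Sum>k\<in>{..<n} - {r}. \<alpha> r (s k) / \<alpha> k (s k))) = 0"
    by (simp add: algebra_simps sum_distrib_left eq_neg_iff_add_eq_0)
  moreover have "1 + (\<Sum>k\<in>{..<n} - {r}. \<alpha> r (s k) / \<alpha> k (s k)) \<noteq> 0"
    using re_pos by (metis less_irrefl zero_complex.sel(1))
  ultimately have t: "t = 0" by simp
  have other: "z k j = 0" if "k \<noteq> r" for k j
  proof (cases "k < n")
    case True
    then show ?thesis using off[OF True that, of j] val[OF True that] t by (cases "j = s k") auto
  next
    case False
    then show ?thesis using E_subset by (intro supp) auto
  qed
  show ?thesis
  proof (cases "i = r")
    case True
    then show ?thesis using other zr[of j] E_subset supp[of i j] by (cases "j \<in> J") auto
  qed (rule other)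
qed

text \<open>Only the servers \<open>s\<close>, \<open>u\<close>, \<open>v\<close> between
  consecutive customers carry flow, and balance leaves the three unknowns \<open>z a s\<close>,
  \<open>z b u\<close>, \<open>z c v\<close>. The rows of \<open>a\<close>, \<open>b\<close> and of
  \<open>c\<close>, \<open>d\<close> each relate \<open>z b u\<close> to \<open>t\<close>, and
  comparing the two forces \<open>t = 0\<close>.\<close>

lemma (in bipartite_tree) path_mode_eq_0:
  fixes z :: "nat \<Rightarrow> 'j \<Rightarrow> complex" and \<mu> :: "nat \<Rightarrow> 'j \<Rightarrow> real"
  assumes supp: "\<And>i j. (i, j) \<notin> E \<Longrightarrow> z i j = 0" and col: "\<And>j. j \<in> J \<Longrightarrow> (\<Sum>i<n. z i j) = 0"
    and row: "\<And>i. i < n \<Longrightarrow> (\<Sum>j\<in>J. (e + of_real (\<mu> i j)) * z i j) = t"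
    and pos: "\<And>i j. (i, j) \<in> E \<Longrightarrow> 0 < \<mu> i j" and re: "0 \<le> Re e"
    and path: "share a b" "share b c" "share c d" "\<not> share a c" "\<not> share b d" "distinct [a, b, c, d]"
    and all: "{..<n} = {a, b, c, d}"
  shows "z i j = 0"
proof -
  define \<alpha> where "\<alpha> i j = e + of_real (\<mu> i j)" for i j
  have \<alpha>: "\<alpha> i j \<noteq> 0" if "(i, j) \<in> E" for i j
    using pos[OF that] re by (auto simp: \<alpha>_def complex_eq_iff)
  have ad: "\<not> share a d" by (rule path_ends_not_share[OF path])
  have ne: "a \<noteq> b" "b \<noteq> c" "c \<noteq> d" "a \<noteq> c" "b \<noteq> d" "a \<noteq> d" using path by auto
  obtain s u v where e: "(a, s) \<in> E" "(b, s) \<in> E" "(b, u) \<in> E" "(c, u) \<in> E" "(c, v) \<in> E" "(d, v) \<in> E"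
    using path by (auto simp: share_def)
  have J: "s \<in> J" "u \<in> J" "v \<in> J" using e E_subset by auto
  have su: "s \<noteq> u" "u \<noteq> v" using e path(4,5) ne by (auto simp: share_def)
  have cust: "m = a \<or> m = b \<or> m = c \<or> m = d" if "(m, j) \<in> E" for m j
    using that E_subset all by blast
  have same: "j = l" if "(x, j) \<in> E" "(y, j) \<in> E" "(x, l) \<in> E" "(y, l) \<in> E" "x \<noteq> y" for x y j l
    using common_server_unique that by blast
  have ns: "\<not> share c a" "\<not> share d b" "\<not> share d a" using path ad share_sym by blast+
  note single = single_customer_eq_0[of z, OF supp col]
  have off_a: "z a j = 0" if "j \<noteq> s" for j
  proof (cases "(a, j) \<in> E")
    case True
    then show ?thesis
      using that cust shareI[OF True] same[of a j b s] e path(4) ad ne by (intro single) blast+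
  qed (rule supp)
  have off_b: "z b j = 0" if "j \<noteq> s" "j \<noteq> u" for j
  proof (cases "(b, j) \<in> E")
    case True
    then show ?thesis
      using that cust shareI[OF True] same[of b j a s] same[of b j c u] e path(5) ne
      by (intro single) blast+
  qed (rule supp)
  have off_c: "z c j = 0" if "j \<noteq> u" "j \<noteq> v" for j
  proof (cases "(c, j) \<in> E")
    case True
    then show ?thesis
      using that cust shareI[OF True] same[of c j b u] same[of c j d v] e ns ne
      by (intro single) blast+
  qed (rule supp)
  have off_d: "z d j = 0" if "j \<noteq> v" for j
  proof (cases "(d, j) \<in> E")
    case True
    then show ?thesis
      using that cust shareI[OF True] same[of d j c v] e ns ne by (intro single) blast+
  qed (rule supp)
  have col4: "z a j + z b j + z c j + z d j = 0" if "j \<in> J" for j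
    using col[OF that] ne by (simp add: all add.assoc)
  have "(c, s) \<notin> E" "(d, s) \<notin> E" "(a, u) \<notin> E" "(d, u) \<notin> E" "(a, v) \<notin> E" "(b, v) \<notin> E"
    using shareI e path ad ns ne by blast+
  then have zb: "z b s = - z a s" and zc: "z c u = - z b u" and zd: "z d v = - z c v"
    using col4[OF J(1)] col4[OF J(2)] col4[OF J(3)] supp by (auto simp: eq_neg_iff_add_eq_0 add.commute)
  have lt: "a < n" "b < n" "c < n" "d < n" using all by auto
  have "(\<Sum>j\<in>J. \<alpha> a j * z a j) = \<alpha> a s * z a s"
    using off_a J finite_J by (intro sum_eq_1) auto
  then have ra: "\<alpha> a s * z a s = t" using row[OF lt(1)] by (simp add: \<alpha>_def)
  have "(\<Sum>j\<in>J. \<alpha> b j * z b j) = \<alpha> b s * z b s + \<alpha> b u * z b u"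
    using off_b J finite_J su by (intro sum_eq_2) auto
  then have rb: "- (\<alpha> b s * z a s) + \<alpha> b u * z b u = t" using row[OF lt(2)] zb by (simp add: \<alpha>_def)
  have "(\<Sum>j\<in>J. \<alpha> c j * z c j) = \<alpha> c u * z c u + \<alpha> c v * z c v"
    using off_c J finite_J su by (intro sum_eq_2) auto
  then have rc: "- (\<alpha> c u * z b u) + \<alpha> c v * z c v = t" using row[OF lt(3)] zc by (simp add: \<alpha>_def)
  have "(\<Sum>j\<in>J. \<alpha> d j * z d j) = \<alpha> d v * z d v"
    using off_d J finite_J by (intro sum_eq_1) auto
  then have rd: "- (\<alpha> d v * z c v) = t" using row[OF lt(4)] zd by (simp add: \<alpha>_def)
  have "\<alpha> b u * z b u = t + \<alpha> b s * z a s" using rb by (simp add: algebra_simps)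
  then have "\<alpha> a s * \<alpha> b u * z b u = \<alpha> a s * (t + \<alpha> b s * z a s)" by simp
  also have "\<dots> = t * \<alpha> a s + (\<alpha> a s * z a s) * \<alpha> b s" by (simp add: algebra_simps)
  finally have left: "t * (\<alpha> a s + \<alpha> b s) = \<alpha> a s * \<alpha> b u * z b u"
    unfolding ra by (simp add: algebra_simps)
  have "\<alpha> c u * z b u = - t + \<alpha> c v * z c v" using rc by (simp add: algebra_simps)
  then have "\<alpha> c u * \<alpha> d v * z b u = \<alpha> d v * (- t + \<alpha> c v * z c v)" by (simp add: mult_ac)
  also have "\<dots> = - (t * \<alpha> d v) - (- (\<alpha> d v * z c v)) * \<alpha> c v" by (simp add: algebra_simps)
  finally have "\<alpha> c u * \<alpha> d v * z b u = - (t * \<alpha> d v) - t * \<alpha> c v" unfolding rd .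
  then have right: "t * (\<alpha> c v + \<alpha> d v) = - (\<alpha> c u * \<alpha> d v * z b u)"
    by (simp add: distrib_left)
  \<comment> \<open>Cross-multiplying \<open>left\<close> and \<open>right\<close> cancels
    \<open>z b u\<close>.\<close>
  have "t * ((\<alpha> a s + \<alpha> b s) * \<alpha> c u * \<alpha> d v + (\<alpha> c v + \<alpha> d v) * \<alpha> b u * \<alpha> a s) =
      t * (\<alpha> a s + \<alpha> b s) * (\<alpha> c u * \<alpha> d v) + t * (\<alpha> c v + \<alpha> d v) * (\<alpha> b u * \<alpha> a s)"
    by (simp add: algebra_simps)
  also have "\<dots> = 0" unfolding left right by (simp add: algebra_simps)
  finally have "t * ((\<alpha> a s + \<alpha> b s) * \<alpha> c u * \<alpha> d v + (\<alpha> c v + \<alpha> d v) * \<alpha> b u * \<alpha> a s) = 0" .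
  moreover have "(\<alpha> a s + \<alpha> b s) * \<alpha> c u * \<alpha> d v + (\<alpha> c v + \<alpha> d v) * \<alpha> b u * \<alpha> a s \<noteq> 0"
    \<comment> \<open>The sums \<alpha> + \<alpha> at the two ends contain \<open>e\<close> twice,
      whence the factors \<open>2 * x\<close> in the determinant lemma.\<close>
    using path_determinant_nonzero[of "\<mu> a s + \<mu> b s" "\<mu> c u" "\<mu> d v" "\<mu> c v + \<mu> d v" "\<mu> b u" "\<mu> a s" e]
      pos e re by (simp add: \<alpha>_def add_pos_pos algebra_simps)
  ultimately have t: "t = 0" by simp
  have z0: "z a s = 0" "z c v = 0" using ra rd t \<alpha> e by auto
  then have "z b u = 0" using rb t \<alpha> e by auto
  then have zs: "z b s = 0" "z b u = 0" "z c u = 0" "z d v = 0" using z0 zb zc zd by simp_all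
  have "z a j = 0" using off_a[of j] z0 by (cases "j = s") auto
  moreover have "z b j = 0" using off_b[of j] zs by (cases "j = s"; cases "j = u") auto
  moreover have "z c j = 0" using off_c[of j] z0 zs by (cases "j = u"; cases "j = v") auto
  moreover have "z d j = 0" using off_d[of j] zs by (cases "j = v") auto
  ultimately show ?thesis using supp[of i j] cust by blast
qed

lemma locally_stable_of_ncust_le_4:
  assumes crit: "critically_loaded S" and le: "ncust S \<le> 4"
  shows "locally_stable S"
  unfolding locally_stable_iff_mode[OF crit]
proof (intro allI impI, elim conjE)
  fix e z i j
  assume mode: "mode S e z" and re: "0 \<le> Re e"
  interpret bipartite_tree "ncust S" "servers S" "basic_activities S"
    by (rule bipartite_tree_basic_activities[OF crit])
  obtain t where supp: "\<And>i j. (i, j) \<notin> basic_activities S \<Longrightarrow> z i j = 0"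
    and col: "\<And>j. j \<in> servers S \<Longrightarrow> (\<Sum>i<ncust S. z i j) = 0"
    and row: "\<And>i. i < ncust S \<Longrightarrow> (\<Sum>j\<in>servers S. (e + of_real (srate S i j)) * z i j) = t"
    using mode unfolding mode_def by blast
  have n: "0 < ncust S" using crit by (simp add: critically_loaded_def valid_system_def)
  have "(\<exists>r<ncust S. \<forall>k<ncust S. k \<noteq> r \<longrightarrow> share k r) \<or>
    (\<exists>a b c d. distinct [a, b, c, d] \<and> {..<ncust S} = {a, b, c, d} \<and> share a b \<and> share b c \<and>
       share c d \<and> \<not> share a c \<and> \<not> share b d)"
  proof (rule connected_graph_le_4[OF n le share_sym])
    fix A i k assume A: "A \<subseteq> {..<ncust S}" "i \<in> A" "k < ncust S" "k \<notin> A"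
    obtain a b j where "a \<in> A" "b < ncust S" "b \<notin> A" "(a, j) \<in> basic_activities S" "(b, j) \<in> basic_activities S"
      using customer_cut[OF A] by blast
    moreover from this have "share a b" by (intro shareI) auto
    ultimately show "\<exists>a\<in>A. \<exists>b<ncust S. b \<notin> A \<and> share a b" by blast
  qed
  then show "z i j = 0"
  proof (elim disjE exE conjE)
    fix r assume "r < ncust S" "\<forall>k<ncust S. k \<noteq> r \<longrightarrow> share k r"
    then show ?thesis
      by (intro dominated_mode_eq_0[of z, OF supp col row srate_basic_pos[OF crit] re]) auto
  next
    fix a b c d
    assume "distinct [a, b, c, d]" "{..<ncust S} = {a, b, c, d}" "share a b" "share b c"
      "share c d" "\<not> share a c" "\<not> share b d"
    then show ?thesis
      by (intro path_mode_eq_0[of z, OF supp col row srate_basic_pos[OF crit] re])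
  qed
qed

theorem lemma5p3:
  fixes S :: "'j system"
  assumes "critically_loaded S"
  shows "(\<forall>i j. 2 \<le> card (servers S) \<and> j \<in> servers S \<and>
             leaf (adjacency (basic_activities S)) (Inr j) \<and> (i, j) \<in> basic_activities S \<longrightarrow>
             critically_loaded (remove_leaf S i j) \<and>
             (locally_stable S \<longleftrightarrow> locally_stable (remove_leaf S i j))) \<and>
         (\<forall>S' :: 'j system. expansion S S' \<longrightarrow> (locally_stable S \<longleftrightarrow> locally_stable S')) \<and>
         (ncust S \<le> 4 \<longrightarrow> locally_stable S)"
proof (intro conjI allI impI)
  fix i j
  assume *: "2 \<le> card (servers S) \<and> j \<in> servers S \<and>
    leaf (adjacency (basic_activities S)) (Inr j) \<and> (i, j) \<in> basic_activities S"
  have "(k, j) \<in> basic_activities S \<longleftrightarrow> k = i" for k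
  proof -
    obtain w where w: "{w. (Inr j, w) \<in> adjacency (basic_activities S)} = {w}"
      using * by (auto simp: leaf_def card_1_singleton_iff)
    have "(l, j) \<in> basic_activities S \<longleftrightarrow> Inl l = w" for l
      using w unfolding set_eq_iff by (metis adjacency_simps(2) mem_Collect_eq singleton_iff)
    then show ?thesis using * by auto
  qed
  note leaf = this
  note removed = remove_leaf_critically_loaded[OF assms _ _ leaf]
  show crit: "critically_loaded (remove_leaf S i j)" using * removed(1) by blast
  have "mode (remove_leaf S i j) e z \<longleftrightarrow> mode S e z" for e z
    using * by (intro mode_remove_leaf_iff assms leaf removed(2)) auto
  then show "locally_stable S \<longleftrightarrow> locally_stable (remove_leaf S i j)"
    unfolding locally_stable_iff_mode[OF assms] locally_stable_iff_mode[OF crit] by simp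
qed (use expansion_locally_stable_iff locally_stable_of_ncust_le_4[OF assms] in auto)

end
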